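(* For a ring $A$ the following assertions are equivalent: (1) $A$ is a ZPI-ring. (2) $A$ is a Noetherian SSP-ring. (3) $A$ is a Noetherian strongly ISP-ring.
   Context: All rings are commutative with a nonzero unit. A ring is a ZPI-ring if every proper ideal of it is a product of prime ideals. A proper ideal $H$ is a radical ideal if $\sqrt H=H$. A ring is an SSP-ring if every proper ideal of it is a product of radical ideals. An element of a ring is regular if it is not a zero-divisor; an ideal is regular if it contains at least one regular element. An ideal $J$ of $A$ is invertible if $JJ'=A$ for some $A$-submodule $J'$ of the total quotient ring $T(A)$; equivalently, $J$ is finitely generated, regular, and $J_M$ is a principal ideal of $A_M$ for each maximal ideal $M$ of $A$ (the ideal $A$ itself is allowed). A ring is a strongly ISP-ring if every proper ideal of it (including the zero ideal) can be written as $JH_1\cdots H_n$ with $J$ an invertible ideal, $n\ge 1$, and all $H_i$ proper radical ideals. *)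

theory Defs
  imports "HOL-Algebra.Ideal_Product" "HOL-Algebra.Ring_Divisibility" "HOL-Algebra.Generated_Groups"
begin

section \<open>Products of ideals, ZPI-rings and SSP-rings\<close>

definition ideal_prod_list :: "('a, 'b) ring_scheme \<Rightarrow> 'a set list \<Rightarrow> 'a set" where
  "ideal_prod_list R Hs = foldr (ideal_prod R) Hs (carrier R)"

definition proper_ideal :: "'a set \<Rightarrow> ('a, 'b) ring_scheme \<Rightarrow> bool" where
  "proper_ideal I R \<longleftrightarrow> ideal I R \<and> I \<noteq> carrier R"

definition ideal_radical :: "('a, 'b) ring_scheme \<Rightarrow> 'a set \<Rightarrow> 'a set" where
  "ideal_radical R I = {x \<in> carrier R. \<exists>n::nat. n \<ge> 1 \<and> x [^]\<^bsub>R\<^esub> n \<in> I}"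

definition radical_ideal :: "'a set \<Rightarrow> ('a, 'b) ring_scheme \<Rightarrow> bool" where
  "radical_ideal H R \<longleftrightarrow> proper_ideal H R \<and> ideal_radical R H = H"

definition zpi_ring :: "('a, 'b) ring_scheme \<Rightarrow> bool" where
  "zpi_ring R \<longleftrightarrow>
    (\<forall>I. proper_ideal I R \<longrightarrow>
      (\<exists>Ps. Ps \<noteq> [] \<and> (\<forall>P \<in> set Ps. primeideal P R) \<and> I = ideal_prod_list R Ps))"

definition ssp_ring :: "('a, 'b) ring_scheme \<Rightarrow> bool" where
  "ssp_ring R \<longleftrightarrow>
    (\<forall>I. proper_ideal I R \<longrightarrow>
      (\<exists>Hs. Hs \<noteq> [] \<and> (\<forall>H \<in> set Hs. radical_ideal H R) \<and> I = ideal_prod_list R Hs))"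


section \<open>The total quotient ring\<close>

text \<open>Regular elements are the non-zero-divisors; the rings considered are commutative, so
  one side suffices.\<close>

definition regular_elems :: "('a, 'b) ring_scheme \<Rightarrow> 'a set" where
  "regular_elems R =
    {s \<in> carrier R. \<forall>x \<in> carrier R. s \<otimes>\<^bsub>R\<^esub> x = \<zero>\<^bsub>R\<^esub> \<longrightarrow> x = \<zero>\<^bsub>R\<^esub>}"

text \<open>The fraction $a/s$ is the class of $(a,s)$ under $(a,s) \sim (b,t)$ iff $at = bs$; since
  only regular denominators occur, this is an equivalence relation.\<close>

definition quot_frac :: "('a, 'b) ring_scheme \<Rightarrow> 'a \<Rightarrow> 'a \<Rightarrow> ('a \<times> 'a) set" where
  "quot_frac R a s = {(b, t). b \<in> carrier R \<and> t \<in> regular_elems R \<and> a \<otimes>\<^bsub>R\<^esub> t = b \<otimes>\<^bsub>R\<^esub> s}"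

text \<open>$T(R)$ as an $R$-algebra. The unions below range over all representatives; by
  \<open>total_quotient_mult\<close>, \<open>total_quotient_add\<close> and \<open>total_quotient_smult\<close> the operations are the
  usual ones on fractions.\<close>

definition total_quotient :: "('a, 'b) ring_scheme \<Rightarrow> ('a, ('a \<times> 'a) set) module" where
  "total_quotient R =
    \<lparr> carrier = {quot_frac R a s | a s. a \<in> carrier R \<and> s \<in> regular_elems R},
      monoid.mult = (\<lambda>x y. \<Union>(a, s) \<in> x. \<Union>(b, t) \<in> y. quot_frac R (a \<otimes>\<^bsub>R\<^esub> b) (s \<otimes>\<^bsub>R\<^esub> t)),
      one = quot_frac R \<one>\<^bsub>R\<^esub> \<one>\<^bsub>R\<^esub>,
      zero = quot_frac R \<zero>\<^bsub>R\<^esub> \<one>\<^bsub>R\<^esub>,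
      add = (\<lambda>x y. \<Union>(a, s) \<in> x. \<Union>(b, t) \<in> y.
               quot_frac R (a \<otimes>\<^bsub>R\<^esub> t \<oplus>\<^bsub>R\<^esub> b \<otimes>\<^bsub>R\<^esub> s) (s \<otimes>\<^bsub>R\<^esub> t)),
      smult = (\<lambda>r x. \<Union>(a, s) \<in> x. quot_frac R (r \<otimes>\<^bsub>R\<^esub> a) s) \<rparr>"

definition base_in_total_quotient :: "('a, 'b) ring_scheme \<Rightarrow> ('a \<times> 'a) set set" where
  "base_in_total_quotient R = (\<lambda>a. quot_frac R a \<one>\<^bsub>R\<^esub>) ` carrier R"

lemma regular_elems_closed: "s \<in> regular_elems R \<Longrightarrow> s \<in> carrier R"
  by (simp add: regular_elems_def)

context cring
begin

lemma regular_cancel: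
  assumes "s \<in> regular_elems R" "x \<in> carrier R" "y \<in> carrier R" "s \<otimes> x = s \<otimes> y"
  shows "x = y"
proof -
  have s: "s \<in> carrier R" using assms(1) by (rule regular_elems_closed)
  have "s \<otimes> (x \<ominus> y) = s \<otimes> x \<ominus> s \<otimes> y"
    using s assms(2,3) by algebra
  also have "\<dots> = \<zero>" using s assms(2-4) by (simp add: r_right_minus_eq)
  finally have "x \<ominus> y = \<zero>"
    using assms(1-3) by (simp add: regular_elems_def)
  then show ?thesis using assms(2,3) r_right_minus_eq by blast
qed

lemma one_regular: "\<one> \<in> regular_elems R"
  by (simp add: regular_elems_def)

lemma mult_regular:
  assumes "s \<in> regular_elems R" "t \<in> regular_elems R"
  shows "s \<otimes> t \<in> regular_elems R"
proof -
  have car: "s \<in> carrier R" "t \<in> carrier R"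
    using assms by (auto intro: regular_elems_closed)
  have "x = \<zero>" if x: "x \<in> carrier R" and eq: "s \<otimes> t \<otimes> x = \<zero>" for x
  proof -
    have "s \<otimes> (t \<otimes> x) = \<zero>" using eq m_assoc[OF car x] by simp
    then have "t \<otimes> x = \<zero>" using assms(1) m_closed[OF car(2) x] unfolding regular_elems_def by blast
    then show ?thesis using assms(2) x unfolding regular_elems_def by blast
  qed
  then show ?thesis using car unfolding regular_elems_def by blast
qed

lemma quot_frac_self:
  "a \<in> carrier R \<Longrightarrow> s \<in> regular_elems R \<Longrightarrow> (a, s) \<in> quot_frac R a s"
  by (simp add: quot_frac_def)

lemma quot_frac_subset:
  assumes "a \<in> carrier R" "b \<in> carrier R" "s \<in> regular_elems R" "t \<in> regular_elems R"
    and eq: "a \<otimes> t = b \<otimes> s"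
  shows "quot_frac R a s \<subseteq> quot_frac R b t"
proof
  fix p assume p: "p \<in> quot_frac R a s"
  obtain c u where [simp]: "p = (c, u)" by (cases p)
  have cu: "c \<in> carrier R" "u \<in> regular_elems R" "a \<otimes> u = c \<otimes> s"
    using p by (auto simp: quot_frac_def)
  have car: "s \<in> carrier R" "t \<in> carrier R" "u \<in> carrier R"
    using assms cu by (auto intro: regular_elems_closed)
  have "s \<otimes> (b \<otimes> u) = (b \<otimes> s) \<otimes> u" using assms car cu by algebra
  also have "\<dots> = (a \<otimes> u) \<otimes> t" unfolding eq[symmetric] using assms(1) car by algebra
  also have "\<dots> = s \<otimes> (c \<otimes> t)" unfolding cu(3) using car cu(1) by algebra
  finally have "b \<otimes> u = c \<otimes> t"
    by (rule regular_cancel[OF assms(3) m_closed[OF assms(2) car(3)] m_closed[OF cu(1) car(2)]])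
  then show "p \<in> quot_frac R b t" using cu by (simp add: quot_frac_def)
qed

lemma quot_frac_eq_iff:
  assumes "a \<in> carrier R" "b \<in> carrier R" "s \<in> regular_elems R" "t \<in> regular_elems R"
  shows "quot_frac R a s = quot_frac R b t \<longleftrightarrow> a \<otimes> t = b \<otimes> s"
proof
  assume "quot_frac R a s = quot_frac R b t"
  then have "(a, s) \<in> quot_frac R b t" using quot_frac_self[OF assms(1,3)] by simp
  then show "a \<otimes> t = b \<otimes> s" by (simp add: quot_frac_def)
next
  assume "a \<otimes> t = b \<otimes> s"
  then show "quot_frac R a s = quot_frac R b t"
    using quot_frac_subset[of a b s t] quot_frac_subset[of b a t s] assms by auto
qed

lemma UN_rep:
  assumes "(a, s) \<in> Z" "\<And>c u. (c, u) \<in> Z \<Longrightarrow> F c u = C"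
  shows "(\<Union>(c, u) \<in> Z. F c u) = C"
proof -
  have "(\<Union>(c, u) \<in> Z. F c u) = (\<Union>p \<in> Z. C)"
    by (rule SUP_cong) (auto simp: assms(2))
  then show ?thesis using assms(1) by auto
qed

lemma total_quotient_mult:
  assumes "a \<in> carrier R" "b \<in> carrier R" "s \<in> regular_elems R" "t \<in> regular_elems R"
  shows "quot_frac R a s \<otimes>\<^bsub>total_quotient R\<^esub> quot_frac R b t = quot_frac R (a \<otimes> b) (s \<otimes> t)"
proof -
  have "quot_frac R (c \<otimes> d) (u \<otimes> v) = quot_frac R (a \<otimes> b) (s \<otimes> t)"
    if "(c, u) \<in> quot_frac R a s" "(d, v) \<in> quot_frac R b t" for c d u v
  proof -
    have cd: "c \<in> carrier R" "u \<in> regular_elems R" "a \<otimes> u = c \<otimes> s"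
      "d \<in> carrier R" "v \<in> regular_elems R" "b \<otimes> v = d \<otimes> t"
      using that by (auto simp: quot_frac_def)
    have car: "s \<in> carrier R" "t \<in> carrier R" "u \<in> carrier R" "v \<in> carrier R"
      using assms cd by (auto intro: regular_elems_closed)
    have "(c \<otimes> d) \<otimes> (s \<otimes> t) = (c \<otimes> s) \<otimes> (d \<otimes> t)" using car cd(1,4) by algebra
    also have "\<dots> = (a \<otimes> b) \<otimes> (u \<otimes> v)"
      unfolding cd(3,6)[symmetric] using car assms(1,2) by algebra
    finally show ?thesis using assms cd by (subst quot_frac_eq_iff) (auto intro: mult_regular)
  qed
  then show ?thesis
    unfolding total_quotient_def monoid.simps ring.simps
    by (intro UN_rep[OF quot_frac_self[OF assms(1,3)]] UN_rep[OF quot_frac_self[OF assms(2,4)]])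
qed

lemma total_quotient_add:
  assumes "a \<in> carrier R" "b \<in> carrier R" "s \<in> regular_elems R" "t \<in> regular_elems R"
  shows "quot_frac R a s \<oplus>\<^bsub>total_quotient R\<^esub> quot_frac R b t
    = quot_frac R (a \<otimes> t \<oplus> b \<otimes> s) (s \<otimes> t)"
proof -
  have "quot_frac R (c \<otimes> v \<oplus> d \<otimes> u) (u \<otimes> v) = quot_frac R (a \<otimes> t \<oplus> b \<otimes> s) (s \<otimes> t)"
    if "(c, u) \<in> quot_frac R a s" "(d, v) \<in> quot_frac R b t" for c d u v
  proof -
    have cd: "c \<in> carrier R" "u \<in> regular_elems R" "a \<otimes> u = c \<otimes> s"
      "d \<in> carrier R" "v \<in> regular_elems R" "b \<otimes> v = d \<otimes> t"
      using that by (auto simp: quot_frac_def)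
    have car: "s \<in> carrier R" "t \<in> carrier R" "u \<in> carrier R" "v \<in> carrier R"
      using assms cd by (auto intro: regular_elems_closed)
    have "(c \<otimes> v \<oplus> d \<otimes> u) \<otimes> (s \<otimes> t) = (c \<otimes> s) \<otimes> (v \<otimes> t) \<oplus> (d \<otimes> t) \<otimes> (u \<otimes> s)"
      using car cd(1,4) by algebra
    also have "\<dots> = (a \<otimes> t \<oplus> b \<otimes> s) \<otimes> (u \<otimes> v)"
      unfolding cd(3,6)[symmetric] using car assms(1,2) by algebra
    finally show ?thesis
      using assms cd car by (subst quot_frac_eq_iff) (auto intro: mult_regular)
  qed
  then show ?thesis
    unfolding total_quotient_def monoid.simps ring.simps
    by (intro UN_rep[OF quot_frac_self[OF assms(1,3)]] UN_rep[OF quot_frac_self[OF assms(2,4)]])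
qed

lemma total_quotient_smult:
  assumes "r \<in> carrier R" "a \<in> carrier R" "s \<in> regular_elems R"
  shows "r \<odot>\<^bsub>total_quotient R\<^esub> quot_frac R a s = quot_frac R (r \<otimes> a) s"
proof -
  have "quot_frac R (r \<otimes> c) u = quot_frac R (r \<otimes> a) s" if "(c, u) \<in> quot_frac R a s" for c u
  proof -
    have cd: "c \<in> carrier R" "u \<in> regular_elems R" "a \<otimes> u = c \<otimes> s"
      using that by (auto simp: quot_frac_def)
    have car: "s \<in> carrier R" "u \<in> carrier R"
      using assms cd by (auto intro: regular_elems_closed)
    have "(r \<otimes> c) \<otimes> s = r \<otimes> (c \<otimes> s)" using car cd(1) assms by algebra
    also have "\<dots> = (r \<otimes> a) \<otimes> u"
      unfolding cd(3)[symmetric] using car assms(1,2) by algebra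
    finally show ?thesis using assms cd by (subst quot_frac_eq_iff) auto
  qed
  then show ?thesis
    unfolding total_quotient_def module.simps
    by (intro UN_rep[OF quot_frac_self[OF assms(2,3)]])
qed

lemma total_quotient_one: "\<one>\<^bsub>total_quotient R\<^esub> = quot_frac R \<one> \<one>"
  by (simp add: total_quotient_def)

lemma total_quotient_zero: "\<zero>\<^bsub>total_quotient R\<^esub> = quot_frac R \<zero> \<one>"
  by (simp add: total_quotient_def)

lemma total_quotient_carrier:
  "carrier (total_quotient R) = {quot_frac R a s | a s. a \<in> carrier R \<and> s \<in> regular_elems R}"
  by (simp add: total_quotient_def)

lemma quot_frac_closed:
  "a \<in> carrier R \<Longrightarrow> s \<in> regular_elems R \<Longrightarrow> quot_frac R a s \<in> carrier (total_quotient R)"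
  by (auto simp: total_quotient_carrier)

lemma total_quotient_cases:
  assumes "x \<in> carrier (total_quotient R)"
  obtains a s where "x = quot_frac R a s" "a \<in> carrier R" "s \<in> regular_elems R" "s \<in> carrier R"
  using assms by (auto simp: total_quotient_carrier intro: regular_elems_closed)

lemmas total_quotient_simps =
  total_quotient_mult total_quotient_add total_quotient_smult
  total_quotient_one total_quotient_zero mult_regular one_regular quot_frac_closed quot_frac_eq_iff

lemma total_quotient_cring: "cring (total_quotient R)"
proof (rule cringI)
  show "abelian_group (total_quotient R)"
  proof (rule abelian_groupI)
    fix x y z
    assume asm: "x \<in> carrier (total_quotient R)" "y \<in> carrier (total_quotient R)"
      "z \<in> carrier (total_quotient R)"
    obtain a s where x: "x = quot_frac R a s" "a \<in> carrier R"
      "s \<in> regular_elems R" "s \<in> carrier R"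
      using asm by (auto elim: total_quotient_cases)
    obtain b t where y: "y = quot_frac R b t" "b \<in> carrier R"
      "t \<in> regular_elems R" "t \<in> carrier R"
      using asm by (auto elim: total_quotient_cases)
    obtain c u where z: "z = quot_frac R c u" "c \<in> carrier R"
      "u \<in> regular_elems R" "u \<in> carrier R"
      using asm by (auto elim: total_quotient_cases)
    have "((a \<otimes> t \<oplus> b \<otimes> s) \<otimes> u \<oplus> c \<otimes> (s \<otimes> t)) \<otimes> (s \<otimes> (t \<otimes> u))
        = (a \<otimes> (t \<otimes> u) \<oplus> (b \<otimes> u \<oplus> c \<otimes> t) \<otimes> s) \<otimes> (s \<otimes> t \<otimes> u)"
      using x(2,4) y(2,4) z(2,4) by algebra
    then show "x \<oplus>\<^bsub>total_quotient R\<^esub> y \<oplus>\<^bsub>total_quotient R\<^esub> z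
        = x \<oplus>\<^bsub>total_quotient R\<^esub> (y \<oplus>\<^bsub>total_quotient R\<^esub> z)"
      using x y z by (simp add: total_quotient_simps)
  next
    fix x y
    assume "x \<in> carrier (total_quotient R)" "y \<in> carrier (total_quotient R)"
    then show "x \<oplus>\<^bsub>total_quotient R\<^esub> y \<in> carrier (total_quotient R)"
      by (elim total_quotient_cases) (simp add: total_quotient_simps)
  next
    fix x y
    assume asm: "x \<in> carrier (total_quotient R)" "y \<in> carrier (total_quotient R)"
    obtain a s where x: "x = quot_frac R a s" "a \<in> carrier R"
      "s \<in> regular_elems R" "s \<in> carrier R"
      using asm by (auto elim: total_quotient_cases)
    obtain b t where y: "y = quot_frac R b t" "b \<in> carrier R"
      "t \<in> regular_elems R" "t \<in> carrier R"
      using asm by (auto elim: total_quotient_cases)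
    have "(a \<otimes> t \<oplus> b \<otimes> s) \<otimes> (t \<otimes> s) = (b \<otimes> s \<oplus> a \<otimes> t) \<otimes> (s \<otimes> t)"
      using x(2,4) y(2,4) by algebra
    then show "x \<oplus>\<^bsub>total_quotient R\<^esub> y = y \<oplus>\<^bsub>total_quotient R\<^esub> x"
      using x y by (simp add: total_quotient_simps)
  next
    fix x assume "x \<in> carrier (total_quotient R)"
    then show "\<zero>\<^bsub>total_quotient R\<^esub> \<oplus>\<^bsub>total_quotient R\<^esub> x = x"
      by (elim total_quotient_cases) (simp add: total_quotient_simps)
  next
    fix x assume "x \<in> carrier (total_quotient R)"
    then obtain a s where x: "x = quot_frac R a s" "a \<in> carrier R" "s \<in> regular_elems R"
      "s \<in> carrier R" by (rule total_quotient_cases)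
    have "\<ominus> a \<otimes> s \<oplus> a \<otimes> s = \<zero>" using x by algebra
    then have "quot_frac R (\<ominus> a) s \<oplus>\<^bsub>total_quotient R\<^esub> x = \<zero>\<^bsub>total_quotient R\<^esub>"
      using x by (simp add: total_quotient_simps)
    then show "\<exists>y \<in> carrier (total_quotient R). y \<oplus>\<^bsub>total_quotient R\<^esub> x = \<zero>\<^bsub>total_quotient R\<^esub>"
      using x by (blast intro: quot_frac_closed a_inv_closed)
  qed (simp add: total_quotient_simps)
next
  show "comm_monoid (total_quotient R)"
  proof (rule comm_monoidI)
    fix x y z
    assume "x \<in> carrier (total_quotient R)" "y \<in> carrier (total_quotient R)"
      "z \<in> carrier (total_quotient R)"
    then show "x \<otimes>\<^bsub>total_quotient R\<^esub> y \<otimes>\<^bsub>total_quotient R\<^esub> z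
        = x \<otimes>\<^bsub>total_quotient R\<^esub> (y \<otimes>\<^bsub>total_quotient R\<^esub> z)"
      by (elim total_quotient_cases) (simp add: total_quotient_simps m_assoc)
  next
    fix x y
    assume "x \<in> carrier (total_quotient R)" "y \<in> carrier (total_quotient R)"
    then show "x \<otimes>\<^bsub>total_quotient R\<^esub> y \<in> carrier (total_quotient R)"
      by (elim total_quotient_cases) (simp add: total_quotient_simps)
  next
    fix x y
    assume "x \<in> carrier (total_quotient R)" "y \<in> carrier (total_quotient R)"
    then show "x \<otimes>\<^bsub>total_quotient R\<^esub> y = y \<otimes>\<^bsub>total_quotient R\<^esub> x"
      by (elim total_quotient_cases) (simp add: total_quotient_simps m_comm)
  next
    fix x assume "x \<in> carrier (total_quotient R)"
    then show "\<one>\<^bsub>total_quotient R\<^esub> \<otimes>\<^bsub>total_quotient R\<^esub> x = x"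
      by (elim total_quotient_cases) (simp add: total_quotient_simps)
  qed (simp add: total_quotient_simps)
next
  fix x y z
  assume asm: "x \<in> carrier (total_quotient R)" "y \<in> carrier (total_quotient R)"
    "z \<in> carrier (total_quotient R)"
  obtain a s where x: "x = quot_frac R a s" "a \<in> carrier R"
    "s \<in> regular_elems R" "s \<in> carrier R"
    using asm by (auto elim: total_quotient_cases)
  obtain b t where y: "y = quot_frac R b t" "b \<in> carrier R"
    "t \<in> regular_elems R" "t \<in> carrier R"
    using asm by (auto elim: total_quotient_cases)
  obtain c u where z: "z = quot_frac R c u" "c \<in> carrier R"
    "u \<in> regular_elems R" "u \<in> carrier R"
    using asm by (auto elim: total_quotient_cases)
  have "(a \<otimes> t \<oplus> b \<otimes> s) \<otimes> c \<otimes> (s \<otimes> u \<otimes> (t \<otimes> u))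
      = (a \<otimes> c \<otimes> (t \<otimes> u) \<oplus> b \<otimes> c \<otimes> (s \<otimes> u)) \<otimes> (s \<otimes> t \<otimes> u)"
    using x(2,4) y(2,4) z(2,4) by algebra
  then show "(x \<oplus>\<^bsub>total_quotient R\<^esub> y) \<otimes>\<^bsub>total_quotient R\<^esub> z
      = x \<otimes>\<^bsub>total_quotient R\<^esub> z \<oplus>\<^bsub>total_quotient R\<^esub> y \<otimes>\<^bsub>total_quotient R\<^esub> z"
    using x y z by (simp add: total_quotient_simps)
qed

lemma total_quotient_algebra: "algebra R (total_quotient R)"
proof (rule algebraI)
  show "cring R" by (rule is_cring)
  show "cring (total_quotient R)" by (rule total_quotient_cring)
next
  fix r x assume "r \<in> carrier R" "x \<in> carrier (total_quotient R)"
  then show "r \<odot>\<^bsub>total_quotient R\<^esub> x \<in> carrier (total_quotient R)"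
    by (elim total_quotient_cases) (simp add: total_quotient_simps)
next
  fix r q x assume asm: "r \<in> carrier R" "q \<in> carrier R" "x \<in> carrier (total_quotient R)"
  obtain a s where x: "x = quot_frac R a s" "a \<in> carrier R"
    "s \<in> regular_elems R" "s \<in> carrier R"
    using asm by (auto elim: total_quotient_cases)
  have "(r \<oplus> q) \<otimes> a \<otimes> (s \<otimes> s) = (r \<otimes> a \<otimes> s \<oplus> q \<otimes> a \<otimes> s) \<otimes> s"
    using asm(1,2) x(2,4) by algebra
  then show "(r \<oplus> q) \<odot>\<^bsub>total_quotient R\<^esub> x
      = r \<odot>\<^bsub>total_quotient R\<^esub> x \<oplus>\<^bsub>total_quotient R\<^esub> q \<odot>\<^bsub>total_quotient R\<^esub> x"
    using asm x by (simp add: total_quotient_simps)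
next
  fix r x y
  assume asm: "r \<in> carrier R" "x \<in> carrier (total_quotient R)" "y \<in> carrier (total_quotient R)"
  obtain a s where x: "x = quot_frac R a s" "a \<in> carrier R"
    "s \<in> regular_elems R" "s \<in> carrier R"
    using asm by (auto elim: total_quotient_cases)
  obtain b t where y: "y = quot_frac R b t" "b \<in> carrier R"
    "t \<in> regular_elems R" "t \<in> carrier R"
    using asm by (auto elim: total_quotient_cases)
  have "r \<otimes> (a \<otimes> t \<oplus> b \<otimes> s) \<otimes> (s \<otimes> t)
      = (r \<otimes> a \<otimes> t \<oplus> r \<otimes> b \<otimes> s) \<otimes> (s \<otimes> t)"
    using asm(1) x(2,4) y(2,4) by algebra
  then show "r \<odot>\<^bsub>total_quotient R\<^esub> (x \<oplus>\<^bsub>total_quotient R\<^esub> y)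
      = r \<odot>\<^bsub>total_quotient R\<^esub> x \<oplus>\<^bsub>total_quotient R\<^esub> r \<odot>\<^bsub>total_quotient R\<^esub> y"
    using asm x y by (simp add: total_quotient_simps)
next
  fix r q x assume "r \<in> carrier R" "q \<in> carrier R" "x \<in> carrier (total_quotient R)"
  then show "(r \<otimes> q) \<odot>\<^bsub>total_quotient R\<^esub> x
      = r \<odot>\<^bsub>total_quotient R\<^esub> (q \<odot>\<^bsub>total_quotient R\<^esub> x)"
    by (elim total_quotient_cases) (simp add: total_quotient_simps m_assoc)
next
  fix x assume "x \<in> carrier (total_quotient R)"
  then show "\<one> \<odot>\<^bsub>total_quotient R\<^esub> x = x"
    by (elim total_quotient_cases) (simp add: total_quotient_simps)
next
  fix r x y
  assume "r \<in> carrier R" "x \<in> carrier (total_quotient R)" "y \<in> carrier (total_quotient R)"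
  then show "(r \<odot>\<^bsub>total_quotient R\<^esub> x) \<otimes>\<^bsub>total_quotient R\<^esub> y
      = r \<odot>\<^bsub>total_quotient R\<^esub> (x \<otimes>\<^bsub>total_quotient R\<^esub> y)"
    by (elim total_quotient_cases) (simp add: total_quotient_simps m_assoc)
qed

lemma base_inj: "inj_on (\<lambda>a. quot_frac R a \<one>) (carrier R)"
  by (auto simp: inj_on_def total_quotient_simps)

lemma regular_inverse:
  assumes "s \<in> regular_elems R"
  shows "quot_frac R s \<one> \<otimes>\<^bsub>total_quotient R\<^esub> quot_frac R \<one> s = \<one>\<^bsub>total_quotient R\<^esub>"
  using assms regular_elems_closed[OF assms] by (simp add: total_quotient_simps)

end


section \<open>Invertible ideals and strongly ISP-rings\<close>

text \<open>The product $JK$ in $T(R)$: all finite sums of elements $j x$ with $j \in J$, $x \in X$.\<close>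

definition ideal_smult :: "('a, 'b) ring_scheme \<Rightarrow> 'a set \<Rightarrow> ('a \<times> 'a) set set \<Rightarrow> ('a \<times> 'a) set set"
  where
  "ideal_smult R J K =
    generate (add_monoid (total_quotient R)) {j \<odot>\<^bsub>total_quotient R\<^esub> x | j x. j \<in> J \<and> x \<in> K}"

definition invertible_ideal :: "'a set \<Rightarrow> ('a, 'b) ring_scheme \<Rightarrow> bool" where
  "invertible_ideal J R \<longleftrightarrow> ideal J R \<and>
    (\<exists>K. submodule K R (total_quotient R) \<and> ideal_smult R J K = base_in_total_quotient R)"

definition strongly_isp_ring :: "('a, 'b) ring_scheme \<Rightarrow> bool" where
  "strongly_isp_ring R \<longleftrightarrow>
    (\<forall>I. proper_ideal I R \<longrightarrow>
      (\<exists>J Hs. invertible_ideal J R \<and> Hs \<noteq> [] \<and> (\<forall>H \<in> set Hs. radical_ideal H R) \<and>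
        I = J \<cdot>\<^bsub>R\<^esub> ideal_prod_list R Hs))"

end

theory Submission
  imports Defs
begin

text \<open>Localisation at a prime \<open>M\<close> is replaced by multiplication with elements outside \<open>M\<close>.

  A Noetherian ring is ZPI as soon as every proper ideal has a proper radical ideal as a factor.
  Indeed, an ideal strictly between \<open>M\<^sup>2\<close> and \<open>M\<close>, for \<open>M\<close> maximal, would be \<open>J M\<close>, hence inside
  \<open>M\<^sup>2\<close> if \<open>J \<subseteq> M\<close> and equal to \<open>M\<close> otherwise. So \<open>M\<close> is locally principal by Nakayama's lemma, and
  a nonmaximal prime vanishes locally. It follows that \<open>I = P (I : P)\<close> for every prime \<open>P \<supseteq> I\<close>, and
  taking for \<open>P\<close> an associated prime of \<open>I\<close>, Noetherian induction factors \<open>I\<close>.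

  For a ZPI-ring it suffices that the primes are finitely generated. A prime \<open>N\<close> that differs
  locally from \<open>N\<^sup>2\<close> is locally principal and contains at most one smaller prime. This gives
  dimension at most one; factoring \<open>0\<close> then shows that maximal ideals are locally principal, and
  that nonmaximal primes are locally zero, hence generated by an idempotent.\<close>

no_notation Sum_Type.Plus (infixr "<+>" 65)

section \<open>Ideals and their products\<close>

lemma ideal_prod_mono:
  assumes "I \<subseteq> I'" "J \<subseteq> J'"
  shows "I \<cdot>\<^bsub>R\<^esub> J \<subseteq> I' \<cdot>\<^bsub>R\<^esub> J'"
proof
  fix x assume "x \<in> I \<cdot>\<^bsub>R\<^esub> J"
  then show "x \<in> I' \<cdot>\<^bsub>R\<^esub> J'"
    by induction (use assms in \<open>auto intro: ideal_prod.intros\<close>)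
qed

lemma ideal_prod_list_Nil [simp]: "ideal_prod_list R [] = carrier R"
  by (simp add: ideal_prod_list_def)

lemma ideal_prod_list_Cons [simp]:
  "ideal_prod_list R (H # Hs) = H \<cdot>\<^bsub>R\<^esub> ideal_prod_list R Hs"
  by (simp add: ideal_prod_list_def)

text \<open>The colon ideal \<open>(I : J)\<close>, which for \<open>I = {\<zero>}\<close> is the
  annihilator of \<open>J\<close>. Local inclusion of \<open>I\<close> in \<open>J\<close> at
  \<open>M\<close> means that \<open>(J : I)\<close> is not inside \<open>M\<close>.\<close>

definition ideal_quot :: "('a, 'b) ring_scheme \<Rightarrow> 'a set \<Rightarrow> 'a set \<Rightarrow> 'a set" where
  "ideal_quot R I J = {a \<in> carrier R. \<forall>x\<in>J. a \<otimes>\<^bsub>R\<^esub> x \<in> I}"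

lemma proper_idealD:
  "proper_ideal I R \<Longrightarrow> ideal I R" "proper_ideal I R \<Longrightarrow> I \<noteq> carrier R"
  by (auto simp: proper_ideal_def)

lemma ideal_subset_carrier: "ideal I R \<Longrightarrow> I \<subseteq> carrier R"
  by (auto intro: ideal.Icarr)

lemma ideal_zero_mem: "ideal I R \<Longrightarrow> \<zero>\<^bsub>R\<^esub> \<in> I"
  by (simp add: additive_subgroup.zero_closed ideal.axioms(1))

lemma ideal_add_mem: "ideal I R \<Longrightarrow> x \<in> I \<Longrightarrow> y \<in> I \<Longrightarrow> x \<oplus>\<^bsub>R\<^esub> y \<in> I"
  by (simp add: additive_subgroup.a_closed ideal.axioms(1))

lemma primeideal_ideal: "primeideal P R \<Longrightarrow> ideal P R"
  by (simp add: primeideal_def)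

lemma maximalideal_ideal: "maximalideal P R \<Longrightarrow> ideal P R"
  by (simp add: maximalideal_def)

context cring
begin

lemma ideal_minus_mem:
  assumes "ideal I R" "x \<in> I" "y \<in> I"
  shows "x \<ominus> y \<in> I"
  using assms by (simp add: a_minus_def ideal_add_mem additive_subgroup.a_inv_closed ideal.axioms(1))

lemma proper_ideal_iff_one: "ideal I R \<Longrightarrow> I \<noteq> carrier R \<longleftrightarrow> \<one> \<notin> I"
  using ideal.one_imp_carrier by blast

lemma primeideal_one: "primeideal P R \<Longrightarrow> \<one> \<notin> P"
  using proper_ideal_iff_one[of P] primeideal.I_notcarr[of P R] primeideal_ideal[of P R] by blast

lemma primeideal_proper: "primeideal P R \<Longrightarrow> proper_ideal P R"
  by (metis primeideal.I_notcarr primeideal_ideal proper_ideal_def)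

lemma ideal_prod_subsetI:
  assumes "ideal K R" "\<And>i j. i \<in> I \<Longrightarrow> j \<in> J \<Longrightarrow> i \<otimes> j \<in> K"
  shows "I \<cdot> J \<subseteq> K"
proof
  fix x assume "x \<in> I \<cdot> J"
  then show "x \<in> K" by induction (use assms ideal_add_mem in auto)
qed

lemma ideal_prod_le:
  assumes "ideal I R" "ideal J R"
  shows "I \<cdot> J \<subseteq> I" "I \<cdot> J \<subseteq> J"
  using ideal_prod_inter[OF assms] by auto

lemma ideal_prod_list_ideal: "(\<And>H. H \<in> set Hs \<Longrightarrow> ideal H R) \<Longrightarrow> ideal (ideal_prod_list R Hs) R"
proof (induction Hs)
  case (Cons H Hs)
  then show ?case by (simp add: ideal_prod_is_ideal)
qed (simp add: oneideal)

text \<open>Commutativity and associativity bring the chosen factor to the front. Only one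
  occurrence is removed, so a repeated factor stays in \<open>Ks\<close>.\<close>

lemma ideal_prod_list_split:
  assumes "\<And>H. H \<in> set Hs \<Longrightarrow> ideal H R" "H \<in> set Hs"
  obtains Ks where "set Ks \<subseteq> set Hs" "length Hs = Suc (length Ks)"
    "ideal_prod_list R Hs = H \<cdot> ideal_prod_list R Ks"
  using assms
proof (induction Hs arbitrary: thesis)
  case (Cons G Gs)
  show ?case
  proof (cases "H = G")
    case True
    then show ?thesis using Cons.prems(1)[of Gs] by auto
  next
    case False
    then have H: "H \<in> set Gs" using Cons.prems by simp
    obtain Ks where Ks: "set Ks \<subseteq> set Gs" "length Gs = Suc (length Ks)"
      "ideal_prod_list R Gs = H \<cdot> ideal_prod_list R Ks"
      using Cons.IH[OF _ _ H] Cons.prems(2) by auto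
    have id: "ideal G R" "ideal H R" "ideal (ideal_prod_list R Ks) R"
      using Cons.prems(2) H Ks(1) by (auto intro!: ideal_prod_list_ideal)
    have "G \<cdot> (H \<cdot> ideal_prod_list R Ks) = H \<cdot> (G \<cdot> ideal_prod_list R Ks)"
      using id by (metis ideal_prod_assoc ideal_prod_commute)
    then show ?thesis using Cons.prems(1)[of "G # Ks"] Ks by auto
  qed
qed simp

lemma ideal_prod_list_le:
  assumes "\<And>H. H \<in> set Hs \<Longrightarrow> ideal H R" "H \<in> set Hs"
  shows "ideal_prod_list R Hs \<subseteq> H"
proof -
  obtain Ks where Ks: "set Ks \<subseteq> set Hs" "ideal_prod_list R Hs = H \<cdot> ideal_prod_list R Ks"
    using ideal_prod_list_split[OF assms] by metis
  then show ?thesis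
    using ideal_prod_le(1)[of H "ideal_prod_list R Ks"] ideal_prod_list_ideal[of Ks] assms by auto
qed

lemma prime_ideal_prod:
  assumes "primeideal P R" "ideal I R" "ideal J R" "I \<cdot> J \<subseteq> P"
  shows "I \<subseteq> P \<or> J \<subseteq> P"
proof (rule ccontr)
  assume "\<not> ?thesis"
  then obtain i j where ij: "i \<in> I" "j \<in> J" "i \<notin> P" "j \<notin> P" by blast
  then have "i \<otimes> j \<in> P" using assms(4) ideal_prod.prod[of i I j J R] by blast
  then show False
    using primeideal.I_prime[OF assms(1)] ij ideal.Icarr[OF assms(2)] ideal.Icarr[OF assms(3)] by blast
qed

lemma prime_ideal_prod_list:
  assumes "primeideal P R" "\<And>H. H \<in> set Hs \<Longrightarrow> ideal H R" "ideal_prod_list R Hs \<subseteq> P"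
  shows "\<exists>H\<in>set Hs. H \<subseteq> P"
  using assms(2,3)
proof (induction Hs)
  case Nil
  then show ?case using primeideal_one[OF assms(1)] by auto
next
  case (Cons H Hs)
  then show ?case
    using prime_ideal_prod[OF assms(1), of H "ideal_prod_list R Hs"] ideal_prod_list_ideal[of Hs]
    by auto
qed

lemma set_add_mem: "i \<in> I \<Longrightarrow> j \<in> J \<Longrightarrow> i \<oplus> j \<in> I <+> J"
  unfolding set_add_def'[of R I J] by blast

lemma set_add_memE:
  assumes "x \<in> I <+> J" obtains i j where "i \<in> I" "j \<in> J" "x = i \<oplus> j"
  using assms unfolding set_add_def'[of R I J] by blast

lemma set_add_ge:
  assumes "ideal I R" "ideal J R"
  shows "I \<subseteq> I <+> J" "J \<subseteq> I <+> J"
  using set_add_mem[of _ I "\<zero>" J] set_add_mem[of "\<zero>" I _ J] assms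
    ideal_zero_mem ideal.Icarr r_zero l_zero by (metis subsetI)+

lemma set_add_le:
  assumes "ideal K R" "I \<subseteq> K" "J \<subseteq> K"
  shows "I <+> J \<subseteq> K"
  using assms ideal_add_mem[OF assms(1)] by (blast elim: set_add_memE)

section \<open>Colon ideals\<close>

lemma ideal_quot_ideal:
  assumes "ideal I R" "J \<subseteq> carrier R"
  shows "ideal (ideal_quot R I J) R"
proof (rule idealI[OF ring_axioms])
  show "subgroup (ideal_quot R I J) (add_monoid R)"
  proof (rule add.subgroupI)
    have "\<zero> \<in> ideal_quot R I J"
      using assms ideal_zero_mem[OF assms(1)] by (auto simp: ideal_quot_def subset_iff)
    then show "ideal_quot R I J \<noteq> {}" by auto
  next
    fix a assume "a \<in> ideal_quot R I J"
    then have a: "a \<in> carrier R" "\<And>x. x \<in> J \<Longrightarrow> a \<otimes> x \<in> I" by (auto simp: ideal_quot_def)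
    have "(\<ominus> a) \<otimes> x \<in> I" if "x \<in> J" for x
    proof -
      have "(\<ominus> a) \<otimes> x = \<zero> \<ominus> a \<otimes> x" using a that assms(2) by (auto simp: l_minus a_minus_def)
      then show ?thesis using ideal_minus_mem[OF assms(1) ideal_zero_mem[OF assms(1)] a(2)[OF that]] by simp
    qed
    then show "\<ominus> a \<in> ideal_quot R I J" using a by (simp add: ideal_quot_def)
  next
    fix a b assume "a \<in> ideal_quot R I J" "b \<in> ideal_quot R I J"
    then show "a \<oplus> b \<in> ideal_quot R I J"
      using assms by (auto simp: ideal_quot_def l_distr subset_iff ideal_add_mem)
  qed (auto simp: ideal_quot_def)
next
  fix a x assume "a \<in> ideal_quot R I J" and x: "x \<in> carrier R"
  then have a: "a \<in> carrier R" "\<And>y. y \<in> J \<Longrightarrow> a \<otimes> y \<in> I" by (auto simp: ideal_quot_def)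
  have "x \<otimes> a \<otimes> y \<in> I" if "y \<in> J" for y
    using a x that assms by (auto simp: m_assoc subset_iff intro: ideal.I_l_closed)
  then show "x \<otimes> a \<in> ideal_quot R I J" "a \<otimes> x \<in> ideal_quot R I J"
    using a x by (auto simp: ideal_quot_def m_comm)
qed

lemma ideal_quot_ge:
  assumes "ideal I R" "J \<subseteq> carrier R"
  shows "I \<subseteq> ideal_quot R I J"
  using ideal.I_r_closed[OF assms(1)] ideal.Icarr[OF assms(1)] assms(2)
  by (auto simp: ideal_quot_def)

lemma ideal_prod_quot_le:
  assumes "ideal I R" "ideal J R"
  shows "J \<cdot> ideal_quot R I J \<subseteq> I"
proof (rule ideal_prod_subsetI[OF assms(1)])
  fix i j assume "i \<in> J" "j \<in> ideal_quot R I J"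
  then show "i \<otimes> j \<in> I"
    using ideal.Icarr[OF assms(2), of i] m_comm[of i j] by (auto simp: ideal_quot_def)
qed

text \<open>Zorn's lemma for the ideals that contain \<open>I\<close> and avoid
  \<open>\<one>\<close>; avoiding \<open>\<one>\<close> passes to unions of chains.\<close>

lemma exists_maximalideal:
  assumes "proper_ideal I R"
  obtains M where "maximalideal M R" "I \<subseteq> M"
proof -
  define S where "S = {J. ideal J R \<and> I \<subseteq> J \<and> \<one> \<notin> J}"
  have IS: "I \<in> S"
    using proper_idealD[OF assms] proper_ideal_iff_one[of I] by (simp add: S_def)
  have "\<exists>U\<in>S. \<forall>X\<in>C. X \<subseteq> U" if C: "subset.chain S C" for C
  proof (cases "C = {}")
    case True
    then show ?thesis using IS by auto
  next
    case False
    have "subset.chain {I. ideal I R} C" using C by (auto simp: pred_on.chain_def S_def)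
    then have "ideal (\<Union>C) R" using chain_Union_is_ideal[of C] False by simp
    moreover have "C \<subseteq> S" using C by (simp add: pred_on.chain_def)
    ultimately have "\<Union>C \<in> S" using False by (auto simp: S_def)
    then show ?thesis by auto
  qed
  then obtain M where M: "M \<in> S" "\<And>X. X \<in> S \<Longrightarrow> M \<subseteq> X \<Longrightarrow> X = M"
    using subset_Zorn[of S] by metis
  have "maximalideal M R"
  proof (rule maximalidealI)
    show "ideal M R" "carrier R \<noteq> M" using M(1) by (auto simp: S_def)
    fix J assume J: "ideal J R" "M \<subseteq> J" "J \<subseteq> carrier R"
    show "J = M \<or> J = carrier R"
    proof (cases "\<one> \<in> J")
      case True
      then show ?thesis using J ideal.one_imp_carrier by blast
    next
      case False
      then show ?thesis using M J by (auto simp: S_def)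
    qed
  qed
  then show ?thesis using that M(1) by (auto simp: S_def)
qed

text \<open>The ideal generated by \<open>s\<close> and \<open>M\<close> is larger than
  \<open>M\<close>, so it contains \<open>\<one>\<close>: here \<open>r\<close> is an inverse of
  \<open>s\<close> modulo \<open>M\<close>.\<close>

lemma maximalideal_cases:
  assumes "maximalideal M R" "s \<in> carrier R" "s \<notin> M"
  obtains r m where "r \<in> carrier R" "m \<in> M" "\<one> = r \<otimes> s \<oplus> m"
proof -
  have id: "ideal M R" by (rule maximalideal_ideal[OF assms(1)])
  let ?J = "PIdl s <+> M"
  have J: "ideal ?J R" by (rule add_ideals[OF cgenideal_ideal[OF assms(2)] id])
  have "M \<subseteq> ?J" "s \<in> ?J"
    using set_add_ge[OF cgenideal_ideal[OF assms(2)] id] cgenideal_self[OF assms(2)] by auto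
  then have "?J = carrier R"
    using maximalideal.I_maximal[OF assms(1) J] ideal_subset_carrier[OF J] assms(3) by blast
  then have "\<one> \<in> ?J" by simp
  then show ?thesis using that by (elim set_add_memE) (auto simp: cgenideal_def)
qed

lemma maximalideal_max:
  assumes "maximalideal M R" "proper_ideal J R" "M \<subseteq> J"
  shows "J = M"
  using maximalideal.I_maximal[OF assms(1) proper_idealD(1)[OF assms(2)] assms(3)]
    ideal_subset_carrier[OF proper_idealD(1)[OF assms(2)]] proper_idealD(2)[OF assms(2)] by simp

end

section \<open>Local inclusion of ideals\<close>

text \<open>For a prime ideal \<open>M\<close> and finitely generated \<open>I\<close>, this is the inclusion of the
  localisations of \<open>I\<close> and \<open>J\<close> at \<open>M\<close>; in general it is stronger.\<close>

definition locally_le :: "('a, 'b) ring_scheme \<Rightarrow> 'a set \<Rightarrow> 'a set \<Rightarrow> 'a set \<Rightarrow> bool" where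
  "locally_le R M I J \<longleftrightarrow> (\<exists>s \<in> carrier R - M. \<forall>x\<in>I. s \<otimes>\<^bsub>R\<^esub> x \<in> J)"

context cring
begin

lemma locally_le_subset:
  assumes "primeideal M R" "ideal J R" "I \<subseteq> J" shows "locally_le R M I J"
proof -
  have "\<one> \<otimes> x \<in> J" if "x \<in> I" for x
    using that assms(3) ideal.Icarr[OF assms(2), of x] by auto
  then show ?thesis
    unfolding locally_le_def using primeideal_one[OF assms(1)] by blast
qed

lemma locally_le_trans:
  assumes "primeideal M R" "I \<subseteq> carrier R" "locally_le R M I J" "locally_le R M J K"
  shows "locally_le R M I K"
proof -
  obtain s where s: "s \<in> carrier R" "s \<notin> M" "\<And>x. x \<in> I \<Longrightarrow> s \<otimes> x \<in> J"
    using assms(3) by (auto simp: locally_le_def)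
  obtain t where t: "t \<in> carrier R" "t \<notin> M" "\<And>x. x \<in> J \<Longrightarrow> t \<otimes> x \<in> K"
    using assms(4) by (auto simp: locally_le_def)
  have "t \<otimes> s \<otimes> x \<in> K" if "x \<in> I" for x
  proof -
    have "t \<otimes> s \<otimes> x = t \<otimes> (s \<otimes> x)"
      using s(1) t(1) that assms(2) by (intro m_assoc) auto
    then show ?thesis using s(3) t(3) that by simp
  qed
  moreover have "t \<otimes> s \<notin> M" using primeideal.I_prime[OF assms(1)] s t by blast
  ultimately show ?thesis using s(1) t(1) unfolding locally_le_def by blast
qed

text \<open>If \<open>s\<close> works for \<open>I\<close> and \<open>t\<close> for
  \<open>J\<close>, then \<open>s \<otimes> t\<close> works for the sum, and it avoids
  \<open>M\<close> because \<open>M\<close> is prime.\<close>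

lemma locally_le_add:
  assumes "primeideal M R" "ideal I R" "ideal J R" "ideal K R"
    "locally_le R M I K" "locally_le R M J K"
  shows "locally_le R M (I <+> J) K"
proof -
  obtain s where s: "s \<in> carrier R" "s \<notin> M" "\<And>x. x \<in> I \<Longrightarrow> s \<otimes> x \<in> K"
    using assms(5) by (auto simp: locally_le_def)
  obtain t where t: "t \<in> carrier R" "t \<notin> M" "\<And>x. x \<in> J \<Longrightarrow> t \<otimes> x \<in> K"
    using assms(6) by (auto simp: locally_le_def)
  have "s \<otimes> t \<otimes> x \<in> K" if x: "x \<in> I <+> J" for x
  proof -
    obtain i j where ij: "i \<in> I" "j \<in> J" "x = i \<oplus> j" using x by (rule set_add_memE)
    have c: "i \<in> carrier R" "j \<in> carrier R" using ij ideal.Icarr[OF assms(2)] ideal.Icarr[OF assms(3)] by auto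
    have "s \<otimes> t \<otimes> x = t \<otimes> (s \<otimes> i) \<oplus> s \<otimes> (t \<otimes> j)" unfolding ij(3) using c s(1) t(1) by algebra
    then show ?thesis
      using ideal_add_mem[OF assms(4)] ideal.I_l_closed[OF assms(4)] s t ij by simp
  qed
  moreover have "s \<otimes> t \<notin> M" using primeideal.I_prime[OF assms(1)] s t by blast
  ultimately show ?thesis using s(1) t(1) unfolding locally_le_def by blast
qed

lemma locally_le_prod:
  assumes "ideal I R" "ideal J R" "ideal K R" "locally_le R M I J"
  shows "locally_le R M (K \<cdot> I) (K \<cdot> J)"
proof -
  obtain s where s: "s \<in> carrier R" "s \<notin> M" "\<And>x. x \<in> I \<Longrightarrow> s \<otimes> x \<in> J"
    using assms(4) by (auto simp: locally_le_def)
  have "s \<otimes> x \<in> K \<cdot> J" if "x \<in> K \<cdot> I" for x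
    using that
  proof induction
    case (prod k i)
    have c: "k \<in> carrier R" "i \<in> carrier R" using prod ideal.Icarr[OF assms(1)] ideal.Icarr[OF assms(3)] by auto
    have "s \<otimes> (k \<otimes> i) = k \<otimes> (s \<otimes> i)" using c s(1) by algebra
    then show ?case using prod s(3) by (simp add: ideal_prod.prod)
  next
    case (sum x y)
    have c: "x \<in> carrier R" "y \<in> carrier R" using sum ideal_prod_in_carrier[OF assms(3,1)] by auto
    have "s \<otimes> (x \<oplus> y) = s \<otimes> x \<oplus> s \<otimes> y" using c s(1) by algebra
    then show ?case using sum by (simp add: ideal_prod.sum)
  qed
  then show ?thesis using s unfolding locally_le_def by blast
qed

text \<open>Locally at \<open>M\<close> the factor \<open>Q\<close> is the unit ideal: any element
  of \<open>Q\<close> outside \<open>M\<close> serves as the multiplier.\<close>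

lemma locally_le_prod_left:
  assumes "ideal I R" "ideal Q R" "\<not> Q \<subseteq> M"
  shows "locally_le R M I (Q \<cdot> I)"
proof -
  obtain s where s: "s \<in> Q" "s \<notin> M" using assms(3) by blast
  then show ?thesis
    unfolding locally_le_def using ideal.Icarr[OF assms(2)] ideal_prod.prod[of s Q _ I R] by blast
qed

text \<open>The factors are absorbed one at a time: those not inside \<open>M\<close> are locally
  trivial, the others are covered by the hypothesis. For a factorisation of the zero ideal this
  makes \<open>P\<close> vanish locally.\<close>

lemma locally_le_prod_list:
  assumes "primeideal M R" "ideal P R" "\<And>Q. Q \<in> set Qs \<Longrightarrow> ideal Q R"
    and "\<And>Q. Q \<in> set Qs \<Longrightarrow> Q \<subseteq> M \<Longrightarrow> locally_le R M P (Q \<cdot> P)"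
  shows "locally_le R M P (P \<cdot> ideal_prod_list R Qs)"
  using assms(3,4)
proof (induction Qs)
  case Nil
  then show ?case using assms by (simp add: ideal_prod_one locally_le_subset)
next
  case (Cons Q Qs)
  let ?L = "ideal_prod_list R Qs"
  have id: "ideal Q R" "ideal ?L R" "ideal (P \<cdot> ?L) R"
    using Cons.prems by (auto intro!: ideal_prod_list_ideal ideal_prod_is_ideal assms(2))
  have "locally_le R M P (Q \<cdot> P)"
    using Cons.prems(2)[of Q] locally_le_prod_left[OF assms(2) id(1)] by auto
  moreover have "locally_le R M (Q \<cdot> P) (Q \<cdot> (P \<cdot> ?L))"
    using Cons by (intro locally_le_prod assms(2) id) auto
  moreover have "Q \<cdot> (P \<cdot> ?L) = P \<cdot> (Q \<cdot> ?L)"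
    using id assms(2) by (metis ideal_prod_assoc ideal_prod_commute)
  ultimately show ?case
    using locally_le_trans[OF assms(1) ideal_subset_carrier[OF assms(2)]] by simp
qed

text \<open>The multipliers carrying \<open>I\<close> into \<open>J\<close> form the ideal
  \<open>(J : I)\<close>. By hypothesis no maximal ideal contains it, so it contains
  \<open>\<one>\<close>.\<close>

lemma local_global:
  assumes "ideal I R" "ideal J R" "\<And>M. maximalideal M R \<Longrightarrow> locally_le R M I J"
  shows "I \<subseteq> J"
proof -
  have Q: "ideal (ideal_quot R J I) R"
    by (rule ideal_quot_ideal[OF assms(2) ideal_subset_carrier[OF assms(1)]])
  have "ideal_quot R J I = carrier R"
  proof (rule ccontr)
    assume "\<not> ?thesis"
    then obtain M where "maximalideal M R" "ideal_quot R J I \<subseteq> M"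
      using exists_maximalideal[of "ideal_quot R J I"] Q by (auto simp: proper_ideal_def)
    then show False using assms(3)[of M] by (auto simp: locally_le_def ideal_quot_def)
  qed
  then have "\<one> \<in> ideal_quot R J I" by simp
  then show ?thesis using ideal.Icarr[OF assms(1)] by (auto simp: ideal_quot_def)
qed

end

section \<open>Locally principal primes\<close>

definition locally_principal :: "('a, 'b) ring_scheme \<Rightarrow> 'a set \<Rightarrow> bool" where
  "locally_principal R M \<longleftrightarrow> (\<exists>x\<in>M. locally_le R M M (PIdl\<^bsub>R\<^esub> x))"

context cring
begin

lemma ideal_prod_cgenidealE:
  assumes "z \<in> I \<cdot> (PIdl a)" "ideal I R" "a \<in> carrier R"
  obtains c where "c \<in> I" "z = c \<otimes> a"
proof -
  have "\<exists>c\<in>I. z = c \<otimes> a"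
    using assms(1)
  proof induction
    case (prod i j)
    then obtain r where r: "r \<in> carrier R" "j = r \<otimes> a" by (auto simp: cgenideal_def)
    have "i \<otimes> j = i \<otimes> r \<otimes> a"
      using r ideal.Icarr[OF assms(2) prod(1)] assms(3) by (simp add: m_assoc)
    then show ?case using ideal.I_r_closed[OF assms(2) prod(1) r(1)] by blast
  next
    case (sum s t)
    then obtain c d where cd: "c \<in> I" "s = c \<otimes> a" "d \<in> I" "t = d \<otimes> a" by blast
    then have "s \<oplus> t = (c \<oplus> d) \<otimes> a"
      using assms(3) ideal.Icarr[OF assms(2)] by (simp add: l_distr)
    then show ?case using ideal_add_mem[OF assms(2) cd(1,3)] by blast
  qed
  then show ?thesis using that by blast
qed

text \<open>Serves as the one-generator form of Nakayama's lemma: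
  \<open>s \<otimes> b = n \<otimes> b\<close> with \<open>n\<close> in the prime gives
  \<open>(s \<ominus> n) \<otimes> b = \<zero>\<close>, with a multiplier that is still outside the
  prime.\<close>

lemma prime_minus_notin:
  assumes "primeideal M R" "s \<in> carrier R" "s \<notin> M" "m \<in> M"
  shows "s \<ominus> m \<in> carrier R" "s \<ominus> m \<notin> M"
proof -
  have id: "ideal M R" and m: "m \<in> carrier R"
    using primeideal_ideal[OF assms(1)] ideal.Icarr assms(4) by metis+
  show "s \<ominus> m \<in> carrier R" using assms m by simp
  show "s \<ominus> m \<notin> M"
  proof
    assume "s \<ominus> m \<in> M"
    then have "(s \<ominus> m) \<oplus> m \<in> M" by (rule ideal_add_mem[OF id _ assms(4)])
    moreover have "(s \<ominus> m) \<oplus> m = s" using assms(2) m by algebra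
    ultimately show False using assms(3) by simp
  qed
qed

lemma prime_mult_notin:
  assumes "primeideal M R" "s \<in> carrier R" "s \<notin> M" "t \<in> carrier R" "t \<notin> M"
  shows "s \<otimes> t \<in> carrier R" "s \<otimes> t \<notin> M"
  using assms primeideal.I_prime[OF assms(1,2,4)] by auto

lemma locally_principalE:
  assumes "locally_principal R M" "primeideal M R"
  obtains x s where "x \<in> M" "x \<in> carrier R" "s \<in> carrier R" "s \<notin> M"
    "\<And>m. m \<in> M \<Longrightarrow> \<exists>c\<in>carrier R. s \<otimes> m = c \<otimes> x"
proof -
  obtain x s where "x \<in> M" "s \<in> carrier R - M" "\<forall>m\<in>M. s \<otimes> m \<in> PIdl x"
    using assms(1) by (auto simp: locally_principal_def locally_le_def)
  then show ?thesis
    using that[of x s] ideal.Icarr[OF primeideal_ideal[OF assms(2)]] by (auto simp: cgenideal_def)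
qed

text \<open>With \<open>x\<close> a local generator of \<open>M\<close>, an element \<open>y\<close>
  of \<open>I\<close> satisfies \<open>s \<otimes> y = a \<otimes> x\<close>. Multiplication by
  \<open>a \<otimes> s\<close> moves all of \<open>M\<close> into \<open>I\<close>, so
  \<open>y\<close> is locally \<open>x\<close> times an element of \<open>(I : M)\<close>.\<close>

lemma locally_principal_quot:
  assumes "primeideal M R" "locally_principal R M" "ideal I R" "I \<subseteq> M"
  shows "locally_le R M I (M \<cdot> ideal_quot R I M)"
proof -
  have id: "ideal M R" by (rule primeideal_ideal[OF assms(1)])
  obtain x s where x: "x \<in> M" "x \<in> carrier R" "s \<in> carrier R" "s \<notin> M"
    and s: "\<And>m. m \<in> M \<Longrightarrow> \<exists>c\<in>carrier R. s \<otimes> m = c \<otimes> x"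
    by (rule locally_principalE[OF assms(2,1)]) metis
  have "s \<otimes> s \<otimes> y \<in> M \<cdot> ideal_quot R I M" if y: "y \<in> I" for y
  proof -
    have yc: "y \<in> carrier R" using ideal.Icarr[OF assms(3) y] .
    obtain a where a: "a \<in> carrier R" "s \<otimes> y = a \<otimes> x" using s assms(4) y by blast
    have "a \<otimes> s \<otimes> m \<in> I" if m: "m \<in> M" for m
    proof -
      have mc: "m \<in> carrier R" using ideal.Icarr[OF id m] .
      obtain c where c: "c \<in> carrier R" "s \<otimes> m = c \<otimes> x" using s[OF m] by blast
      have "a \<otimes> s \<otimes> m = a \<otimes> (s \<otimes> m)" using a x mc by (simp add: m_assoc)
      also have "\<dots> = c \<otimes> (a \<otimes> x)" unfolding c(2) using a c x by algebra
      also have "\<dots> = c \<otimes> s \<otimes> y" unfolding a(2)[symmetric] using c x yc by (simp add: m_assoc)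
      finally show ?thesis using ideal.I_l_closed[OF assms(3) y] c(1) x(3) by simp
    qed
    then have "a \<otimes> s \<in> ideal_quot R I M" using a x by (simp add: ideal_quot_def)
    moreover have "s \<otimes> s \<otimes> y = x \<otimes> (a \<otimes> s)"
    proof -
      have "s \<otimes> s \<otimes> y = s \<otimes> (s \<otimes> y)" using x yc by (simp add: m_assoc)
      then show ?thesis unfolding a(2) using a x by algebra
    qed
    ultimately show ?thesis using x(1) by (simp add: ideal_prod.prod)
  qed
  then show ?thesis
    using prime_mult_notin[OF assms(1) x(3,4,3,4)] unfolding locally_le_def by blast
qed

text \<open>Since \<open>Q\<close> is prime and does not contain \<open>N\<close>, the colon ideal
  \<open>(Q : N)\<close> is inside \<open>Q\<close>; now \<open>locally_principal_quot\<close>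
  applies with \<open>I = Q\<close>.\<close>

lemma locally_principal_smaller_prime:
  assumes "primeideal N R" "locally_principal R N" "primeideal Q R" "Q \<subset> N"
  shows "locally_le R N Q (N \<cdot> Q)"
proof -
  have idQ: "ideal Q R" and idN: "ideal N R"
    using primeideal_ideal assms by blast+
  have "ideal_quot R Q N \<subseteq> Q"
  proof
    fix a assume a: "a \<in> ideal_quot R Q N"
    obtain n where n: "n \<in> N" "n \<notin> Q" using assms(4) by blast
    then have "a \<otimes> n \<in> Q" "a \<in> carrier R" using a by (auto simp: ideal_quot_def)
    then show "a \<in> Q"
      using primeideal.I_prime[OF assms(3), of a n] n ideal.Icarr[OF idN] by blast
  qed
  then have "N \<cdot> ideal_quot R Q N \<subseteq> N \<cdot> Q" by (intro ideal_prod_mono) auto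
  moreover have "locally_le R N Q (N \<cdot> ideal_quot R Q N)"
    using locally_principal_quot[OF assms(1,2) idQ] assms(4) by blast
  ultimately show ?thesis by (auto simp: locally_le_def)
qed

end

section \<open>Prime ideals of ZPI-rings\<close>

context cring
begin

text \<open>The prime \<open>N\<close> contains a product of primes, hence one of the factors; this
  factor is moved to the front.\<close>

lemma zpi_factorE:
  assumes "zpi_ring R" "primeideal N R" "ideal I R" "I \<subseteq> N"
  obtains Q Ps where "primeideal Q R" "Q \<subseteq> N" "\<And>P. P \<in> set Ps \<Longrightarrow> primeideal P R"
    "I = Q \<cdot> ideal_prod_list R Ps" "ideal (ideal_prod_list R Ps) R"
proof -
  have "proper_ideal I R"
    using assms primeideal_one[OF assms(2)] by (auto simp: proper_ideal_def)
  then obtain Ps where Ps: "\<And>P. P \<in> set Ps \<Longrightarrow> primeideal P R" "I = ideal_prod_list R Ps"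
    using assms(1) by (auto simp: zpi_ring_def)
  obtain Q where Q: "Q \<in> set Ps" "Q \<subseteq> N"
    using prime_ideal_prod_list[OF assms(2), of Ps] Ps assms(4) primeideal_ideal by blast
  obtain Ks where Ks: "set Ks \<subseteq> set Ps" "ideal_prod_list R Ps = Q \<cdot> ideal_prod_list R Ks"
    using ideal_prod_list_split[OF _ Q(1)] Ps(1) primeideal_ideal by metis
  show ?thesis
  proof (rule that)
    show "ideal (ideal_prod_list R Ks) R"
      using Ks(1) Ps(1) by (intro ideal_prod_list_ideal) (auto intro: primeideal_ideal)
  qed (use Ps Q Ks in auto)
qed

text \<open>If \<open>N\<close> were locally equal to \<open>N\<^sup>2\<close> modulo \<open>Q\<close>, it could be cancelled from the
  factorisation of the ideal \<open>(b) + Q\<close>, which is principal modulo \<open>Q\<close>.\<close>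

lemma prime_factor_not_idempotent:
  assumes "primeideal Q R" "primeideal N R" "ideal L R" "Q \<subseteq> N"
    and b: "b \<in> carrier R" "b \<notin> Q" and eq: "PIdl b <+> Q = N \<cdot> L"
  obtains x where "x \<in> N" "\<And>s. s \<in> carrier R \<Longrightarrow> s \<notin> N \<Longrightarrow> s \<otimes> x \<notin> N \<cdot> N"
proof (rule ccontr)
  assume "\<not> thesis"
  then have *: "\<And>x. x \<in> N \<Longrightarrow> \<exists>s\<in>carrier R - N. s \<otimes> x \<in> N \<cdot> N" using that by blast
  have id: "ideal Q R" "ideal N R" "ideal (PIdl b) R"
    using assms by (auto intro: primeideal_ideal cgenideal_ideal)
  have loc: "\<exists>s\<in>carrier R - N. s \<otimes> z \<in> N \<cdot> (N \<cdot> L)" if "z \<in> N \<cdot> L" for z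
    using that
  proof induction
    case (prod n l)
    obtain s where s: "s \<in> carrier R - N" "s \<otimes> n \<in> N \<cdot> N" using *[OF prod(1)] by blast
    have "s \<otimes> n \<otimes> l \<in> N \<cdot> N \<cdot> L" using s(2) prod(2) by (rule ideal_prod.prod)
    moreover have "s \<otimes> n \<otimes> l = s \<otimes> (n \<otimes> l)"
      using s prod ideal.Icarr[OF id(2)] ideal.Icarr[OF assms(3)] by (auto simp: m_assoc)
    ultimately show ?case using s(1) ideal_prod_assoc[OF id(2,2) assms(3)] by auto
  next
    case (sum x y)
    then obtain s t where st: "s \<in> carrier R" "s \<notin> N" "s \<otimes> x \<in> N \<cdot> (N \<cdot> L)"
      "t \<in> carrier R" "t \<notin> N" "t \<otimes> y \<in> N \<cdot> (N \<cdot> L)" by blast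
    have c: "x \<in> carrier R" "y \<in> carrier R"
      using sum(1,2) ideal_prod_in_carrier[OF id(2) assms(3)] by auto
    have K: "ideal (N \<cdot> (N \<cdot> L)) R" by (intro ideal_prod_is_ideal id assms(3))
    have "s \<otimes> t \<otimes> (x \<oplus> y) = t \<otimes> (s \<otimes> x) \<oplus> s \<otimes> (t \<otimes> y)" using c st by algebra
    moreover have "t \<otimes> (s \<otimes> x) \<oplus> s \<otimes> (t \<otimes> y) \<in> N \<cdot> (N \<cdot> L)"
      by (rule ideal_add_mem[OF K ideal.I_l_closed[OF K st(3,4)] ideal.I_l_closed[OF K st(6,1)]])
    ultimately show ?case
      using prime_mult_notin[OF assms(2) st(1,2,4,5)] by (intro bexI[of _ "s \<otimes> t"]) auto
  qed
  have "b \<in> N \<cdot> L"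
    using set_add_ge(1)[OF id(3,1)] cgenideal_self[OF b(1)] eq by blast
  then obtain s where s: "s \<in> carrier R" "s \<notin> N" "s \<otimes> b \<in> N \<cdot> (PIdl b <+> Q)"
    using loc eq by auto
  \<comment> \<open>Modulo \<open>Q\<close> the ideal \<open>PIdl b <+> Q\<close> is generated by
    \<open>b\<close>, so \<open>s \<otimes> b\<close> is congruent to some
    \<open>n \<otimes> b\<close> with \<open>n\<close> in \<open>N\<close>.\<close>
  have "N \<cdot> (PIdl b <+> Q) \<subseteq> N \<cdot> (PIdl b) <+> Q"
    using ideal_prod_r_distr[OF id(2,3,1)] ideal_prod_le(2)[OF id(2,1)]
    by (auto intro: set_add_mem elim!: set_add_memE)
  then obtain z q where zq: "z \<in> N \<cdot> (PIdl b)" "q \<in> Q" "s \<otimes> b = z \<oplus> q"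
    using s(3) by (blast elim: set_add_memE)
  obtain n where n: "n \<in> N" "z = n \<otimes> b"
    using ideal_prod_cgenidealE[OF zq(1) id(2) b(1)] by blast
  have c: "n \<in> carrier R" "q \<in> carrier R"
    using ideal.Icarr[OF id(2) n(1)] ideal.Icarr[OF id(1) zq(2)] by auto
  have "(s \<ominus> n) \<otimes> b = s \<otimes> b \<ominus> n \<otimes> b" using c s(1) b(1) by algebra
  also have "\<dots> = q" unfolding zq(3) n(2) using c b(1) by algebra
  finally have "(s \<ominus> n) \<otimes> b \<in> Q" using zq(2) by simp
  \<comment> \<open>As \<open>b\<close> is outside the prime \<open>Q\<close>, the other factor lies
    in \<open>Q\<close>, hence in \<open>N\<close>, although \<open>s\<close> is outside
    \<open>N\<close>.\<close>
  then have "s \<ominus> n \<in> Q"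
    using primeideal.I_prime[OF assms(1), of "s \<ominus> n" b] b c s by auto
  then show False using prime_minus_notin[OF assms(2) s(1,2) n(1)] assms(4) by blast
qed

text \<open>Since \<open>x\<close> is not in \<open>N\<^sup>2\<close> locally, an ideal between \<open>(x)\<close> and \<open>N\<close> is locally prime;
  applied to \<open>(x) + (y\<^sup>2)\<close> this puts every \<open>y \<in> N\<close> locally into \<open>(x)\<close>.\<close>

lemma zpi_locally_principal:
  assumes z: "zpi_ring R" and N: "primeideal N R" and x: "x \<in> N"
    and nx: "\<And>s. s \<in> carrier R \<Longrightarrow> s \<notin> N \<Longrightarrow> s \<otimes> x \<notin> N \<cdot> N"
  shows "locally_principal R N"
proof -
  have idN: "ideal N R" by (rule primeideal_ideal[OF N])
  have xc: "x \<in> carrier R" by (rule ideal.Icarr[OF idN x])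
  have xNN: "x \<notin> N \<cdot> N" using nx[of "\<one>"] primeideal_one[OF N] xc by auto
  have idx: "ideal (PIdl x) R" by (rule cgenideal_ideal[OF xc])
  \<comment> \<open>One prime factor \<open>Q\<close> of \<open>I\<close> lies in \<open>N\<close>.
    The cofactor does not, as otherwise \<open>x\<close> would be in \<open>N \<cdot> N\<close>; an
    element of it outside \<open>N\<close> gives \<open>s\<close>.\<close>
  have fac: "\<exists>Q s. primeideal Q R \<and> Q \<subseteq> N \<and> I \<subseteq> Q \<and> s \<in> carrier R \<and> s \<notin> N \<and> (\<forall>q\<in>Q. s \<otimes> q \<in> I)"
    if I: "ideal I R" "I \<subseteq> N" "x \<in> I" for I
  proof -
    obtain Q Ps where Q: "primeideal Q R" "Q \<subseteq> N" "I = Q \<cdot> ideal_prod_list R Ps"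
      "ideal (ideal_prod_list R Ps) R"
      by (rule zpi_factorE[OF z N I(1,2)]) metis
    have idQ: "ideal Q R" by (rule primeideal_ideal[OF Q(1)])
    have "\<not> ideal_prod_list R Ps \<subseteq> N"
      using ideal_prod_mono[OF Q(2), of "ideal_prod_list R Ps" N R] Q(3) I(3) xNN by blast
    then obtain s where s: "s \<in> ideal_prod_list R Ps" "s \<notin> N" by blast
    have sc: "s \<in> carrier R" by (rule ideal.Icarr[OF Q(4) s(1)])
    have "s \<otimes> q \<in> I" if "q \<in> Q" for q
      using ideal_prod.prod[OF that s(1), of R] Q(3) m_comm[OF sc ideal.Icarr[OF idQ that]] by simp
    moreover have "I \<subseteq> Q" using ideal_prod_le(1)[OF idQ Q(4)] Q(3) by simp
    ultimately show ?thesis using Q(1,2) s(2) sc by blast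
  qed
  obtain Q s where Q: "primeideal Q R" "Q \<subseteq> N" "PIdl x \<subseteq> Q"
    and s: "s \<in> carrier R" "s \<notin> N" "\<And>q. q \<in> Q \<Longrightarrow> s \<otimes> q \<in> PIdl x"
    using fac[OF idx cgenideal_minimal[OF idN x] cgenideal_self[OF xc]] by blast
  have "y \<in> Q" if y: "y \<in> N" for y
  proof -
    have yc: "y \<in> carrier R" by (rule ideal.Icarr[OF idN y])
    have idy: "ideal (PIdl (y \<otimes> y)) R" using yc by (intro cgenideal_ideal) simp
    let ?I = "PIdl x <+> PIdl (y \<otimes> y)"
    have I: "ideal ?I R" by (rule add_ideals[OF idx idy])
    have "?I \<subseteq> N"
      using yc y by (intro set_add_le idN cgenideal_minimal x ideal.I_l_closed)
    moreover have xI: "x \<in> ?I" "y \<otimes> y \<in> ?I"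
      using set_add_ge[OF idx idy] cgenideal_self[OF xc] cgenideal_self[of "y \<otimes> y"] yc by auto
    ultimately obtain Q' t where Q': "primeideal Q' R" "?I \<subseteq> Q'" "t \<in> carrier R" "t \<notin> N"
      "\<And>q. q \<in> Q' \<Longrightarrow> t \<otimes> q \<in> ?I"
      using fac[OF I] by blast
    have "y \<in> Q'" using primeideal.I_prime[OF Q'(1) yc yc] xI Q'(2) by blast
    then have "t \<otimes> y \<in> ?I" by (rule Q'(5))
    then obtain u v where uv: "u \<in> PIdl x" "v \<in> PIdl (y \<otimes> y)" "t \<otimes> y = u \<oplus> v"
      by (rule set_add_memE)
    obtain r where r: "r \<in> carrier R" "v = r \<otimes> (y \<otimes> y)" using uv(2) by (auto simp: cgenideal_def)
    have uc: "u \<in> carrier R" by (rule ideal.Icarr[OF idx uv(1)])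
    \<comment> \<open>The term \<open>r \<otimes> (y \<otimes> y)\<close> is absorbed into the
      multiplier of \<open>y\<close>, which stays outside \<open>N\<close> and hence outside
      \<open>Q\<close>; so primality of \<open>Q\<close> yields \<open>y \<in> Q\<close>.\<close>
    have "(t \<ominus> r \<otimes> y) \<otimes> y = t \<otimes> y \<ominus> r \<otimes> (y \<otimes> y)" using Q'(3) r yc by algebra
    also have "\<dots> = u" unfolding uv(3) r(2) using uc r yc by algebra
    finally have "(t \<ominus> r \<otimes> y) \<otimes> y \<in> Q" using uv(1) Q(3) by auto
    moreover have "t \<ominus> r \<otimes> y \<in> carrier R" "t \<ominus> r \<otimes> y \<notin> N"
      using prime_minus_notin[OF N Q'(3,4) ideal.I_l_closed[OF idN y r(1)]] by auto
    ultimately show ?thesis using primeideal.I_prime[OF Q(1) _ yc] Q(2) by blast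
  qed
  then have "\<forall>m\<in>N. s \<otimes> m \<in> PIdl x" using s(3) by blast
  then show ?thesis using x s unfolding locally_principal_def locally_le_def by blast
qed

text \<open>A prime factor \<open>Q'\<close> of \<open>PIdl p\<close> inside \<open>Q\<close>
  satisfies \<open>Q' = N \<cdot> Q'\<close> locally, hence
  \<open>PIdl p = N \<cdot> (PIdl p)\<close> locally, and
  \<open>s \<otimes> p = n \<otimes> p\<close> for some \<open>n\<close> in \<open>N\<close>. Then
  \<open>s \<ominus> n\<close> annihilates \<open>p\<close>.\<close>

lemma zpi_smaller_prime_annihilated:
  assumes z: "zpi_ring R" and N: "primeideal N R" "locally_principal R N"
    and Q: "primeideal Q R" "Q \<subset> N" and p: "p \<in> Q"
  shows "\<exists>s\<in>carrier R - N. s \<otimes> p = \<zero>"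
proof -
  have pc: "p \<in> carrier R" using ideal.Icarr[OF primeideal_ideal[OF Q(1)] p] .
  have idN: "ideal N R" by (rule primeideal_ideal[OF N(1)])
  obtain Q' Ps where Q': "primeideal Q' R" "Q' \<subseteq> Q" "PIdl p = Q' \<cdot> ideal_prod_list R Ps"
    and L: "ideal (ideal_prod_list R Ps) R"
    by (rule zpi_factorE[OF z Q(1) cgenideal_ideal[OF pc]
          cgenideal_minimal[OF primeideal_ideal[OF Q(1)] p]]) metis
  let ?L = "ideal_prod_list R Ps"
  have idQ: "ideal Q' R" by (rule primeideal_ideal[OF Q'(1)])
  have "Q' \<subset> N" using Q' Q by blast
  then have "locally_le R N Q' (N \<cdot> Q')"
    by (rule locally_principal_smaller_prime[OF N Q'(1)])
  then have "locally_le R N (?L \<cdot> Q') (?L \<cdot> (N \<cdot> Q'))"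
    by (intro locally_le_prod idQ L ideal_prod_is_ideal idN)
  moreover have "?L \<cdot> Q' = PIdl p" using Q'(3) idQ L ideal_prod_commute by simp
  moreover have "?L \<cdot> (N \<cdot> Q') = N \<cdot> (PIdl p)"
    using Q'(3) idQ L idN by (metis ideal_prod_assoc ideal_prod_commute)
  ultimately obtain s where s: "s \<in> carrier R" "s \<notin> N" "s \<otimes> p \<in> N \<cdot> (PIdl p)"
    using cgenideal_self[OF pc] by (auto simp: locally_le_def)
  obtain n where n: "n \<in> N" "s \<otimes> p = n \<otimes> p"
    using ideal_prod_cgenidealE[OF s(3) idN pc] by blast
  have nc: "n \<in> carrier R" by (rule ideal.Icarr[OF idN n(1)])
  have "(s \<ominus> n) \<otimes> p = s \<otimes> p \<ominus> n \<otimes> p" using nc pc s(1) by algebra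
  also have "\<dots> = \<zero>" unfolding n(2) using nc pc by algebra
  finally show ?thesis using prime_minus_notin[OF N(1) s(1,2) n(1)] by blast
qed

text \<open>Each element of one prime is annihilated by some \<open>s\<close> outside
  \<open>N\<close>, hence outside the other prime, which therefore contains the element.\<close>

lemma zpi_smaller_prime_unique:
  assumes "zpi_ring R" "primeideal N R" "locally_principal R N"
    and "primeideal P R" "P \<subset> N" "primeideal Q R" "Q \<subset> N"
  shows "P = Q"
proof -
  have "P \<subseteq> Q" if P: "primeideal P R" "P \<subset> N" and Q: "primeideal Q R" "Q \<subset> N" for P Q
  proof
    fix p assume p: "p \<in> P"
    then obtain s where s: "s \<in> carrier R" "s \<notin> N" "s \<otimes> p = \<zero>"
      using zpi_smaller_prime_annihilated[OF assms(1-3) P] by blast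
    have "s \<otimes> p \<in> Q" using s(3) ideal_zero_mem[OF primeideal_ideal[OF Q(1)]] by simp
    then show "p \<in> Q"
      using primeideal.I_prime[OF Q(1) s(1), of p] s(2) Q(2)
        ideal.Icarr[OF primeideal_ideal[OF P(1)] p] by blast
  qed
  then show ?thesis using assms by blast
qed

text \<open>For \<open>a\<close> in \<open>M\<close> but not in \<open>P\<close>, some prime factor
  \<open>N\<close> of \<open>PIdl a <+> P\<close> lies in \<open>M\<close>. Modulo \<open>P\<close>
  this ideal is principal and nonzero, so \<open>prime_factor_not_idempotent\<close> and
  \<open>zpi_locally_principal\<close> apply.\<close>

lemma zpi_locally_principal_between:
  assumes z: "zpi_ring R" and P: "primeideal P R" and M: "primeideal M R" "P \<subset> M"
  obtains N where "primeideal N R" "P \<subset> N" "N \<subseteq> M" "locally_principal R N"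
proof -
  obtain a where a: "a \<in> M" "a \<notin> P" using M(2) by blast
  have idP: "ideal P R" and idM: "ideal M R" using P M primeideal_ideal by blast+
  have ac: "a \<in> carrier R" by (rule ideal.Icarr[OF idM a(1)])
  have ida: "ideal (PIdl a) R" by (rule cgenideal_ideal[OF ac])
  have "PIdl a <+> P \<subseteq> M"
    using a M by (intro set_add_le idM cgenideal_minimal) auto
  then obtain N Ps where N: "primeideal N R" "N \<subseteq> M" "PIdl a <+> P = N \<cdot> ideal_prod_list R Ps"
    "ideal (ideal_prod_list R Ps) R"
    by (rule zpi_factorE[OF z M(1) add_ideals[OF ida idP]]) metis
  have "PIdl a <+> P \<subseteq> N"
    using ideal_prod_le(1)[OF primeideal_ideal[OF N(1)] N(4)] N(3) by simp
  then have PN: "P \<subseteq> N" "a \<in> N"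
    using set_add_ge[OF ida idP] cgenideal_self[OF ac] by blast+
  obtain x where "x \<in> N" "\<And>s. s \<in> carrier R \<Longrightarrow> s \<notin> N \<Longrightarrow> s \<otimes> x \<notin> N \<cdot> N"
    by (rule prime_factor_not_idempotent[OF P N(1,4) PN(1) ac a(2) N(3)]) metis
  then have "locally_principal R N" by (rule zpi_locally_principal[OF z N(1)])
  then show ?thesis using that N PN a by blast
qed

text \<open>If the locally principal prime found between \<open>P\<close> and \<open>M\<close> were
  smaller than \<open>M\<close>, a second one above it would contain two different smaller primes,
  against \<open>zpi_smaller_prime_unique\<close>. The same contradiction in a maximal ideal above
  \<open>M\<close> gives maximality.\<close>

lemma zpi_larger_prime:
  assumes z: "zpi_ring R" and P: "primeideal P R" and M: "primeideal M R" "P \<subset> M"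
  shows "locally_principal R M" "maximalideal M R"
proof -
  have lp: "locally_principal R M'" if M': "primeideal M' R" "P \<subset> M'" for M'
  proof -
    obtain Q where Q: "primeideal Q R" "P \<subset> Q" "Q \<subseteq> M'" "locally_principal R Q"
      by (rule zpi_locally_principal_between[OF z P M'])
    show ?thesis
    proof (cases "Q = M'")
      case False
      then have "Q \<subset> M'" using Q by blast
      then obtain N where N: "primeideal N R" "Q \<subset> N" "locally_principal R N"
        by (rule zpi_locally_principal_between[OF z Q(1) M'(1)])
      then have "P = Q" using zpi_smaller_prime_unique[OF z N(1,3) P _ Q(1)] Q(2) by blast
      then show ?thesis using Q by blast
    qed (use Q in simp)
  qed
  show "locally_principal R M" by (rule lp[OF M])
  obtain M' where M': "maximalideal M' R" "M \<subseteq> M'"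
    by (rule exists_maximalideal[OF primeideal_proper[OF M(1)]])
  have pr: "primeideal M' R" by (rule maximalideal_prime[OF M'(1)])
  have "M = M'"
  proof (rule ccontr)
    assume "M \<noteq> M'"
    then have "M \<subset> M'" using M' by blast
    then have "P = M"
      using zpi_smaller_prime_unique[OF z pr lp[OF pr] P _ M(1)] M(2) by blast
    then show False using M(2) by blast
  qed
  then show "maximalideal M R" using M' by simp
qed

lemma zpi_zero_factorE:
  assumes "zpi_ring R" "\<one> \<noteq> \<zero>"
  obtains Ps where "\<And>P. P \<in> set Ps \<Longrightarrow> primeideal P R" "ideal_prod_list R Ps = {\<zero>}"
proof -
  have "proper_ideal {\<zero>} R" using assms(2) zeroideal by (auto simp: proper_ideal_def)
  then show ?thesis using that assms(1) by (metis zpi_ring_def)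
qed

text \<open>The only primes inside \<open>M\<close> are \<open>P\<close> and \<open>M\<close>, and
  \<open>P = M \<cdot> P\<close> locally. If also \<open>P = P \<cdot> P\<close>, then
  \<open>P\<close> absorbs the factors of the zero ideal. Otherwise an element of \<open>P\<close>
  outside \<open>P \<cdot> P\<close> generates \<open>P\<close> locally and is locally
  annihilated.\<close>

lemma zpi_nonmaximal_prime_locally_zero:
  assumes z: "zpi_ring R" and nz: "\<one> \<noteq> \<zero>"
    and P: "primeideal P R" and M: "primeideal M R" "P \<subset> M"
  shows "locally_le R M P {\<zero>}"
proof -
  have lp: "locally_principal R M" by (rule zpi_larger_prime[OF z P M])
  have idP: "ideal P R" and idM: "ideal M R" using P M primeideal_ideal by blast+
  have PM: "locally_le R M P (M \<cdot> P)" by (rule locally_principal_smaller_prime[OF M(1) lp P M(2)])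
  have prime_cases: "Q = P \<or> Q = M" if "primeideal Q R" "Q \<subseteq> M" for Q
    using zpi_smaller_prime_unique[OF z M(1) lp that(1) _ P M(2)] that(2) by blast
  show ?thesis
  proof (cases "P \<subseteq> P \<cdot> P")
    case True
    obtain Ps where Ps: "\<And>Q. Q \<in> set Ps \<Longrightarrow> primeideal Q R" "ideal_prod_list R Ps = {\<zero>}"
      by (rule zpi_zero_factorE[OF z nz]) metis
    have "locally_le R M P (Q \<cdot> P)" if "Q \<in> set Ps" "Q \<subseteq> M" for Q
      using prime_cases[OF Ps(1)[OF that(1)] that(2)] PM
        locally_le_subset[OF M(1) ideal_prod_is_ideal[OF idP idP] True] by blast
    then have "locally_le R M P (P \<cdot> ideal_prod_list R Ps)"
      using Ps(1) by (intro locally_le_prod_list M(1) idP) (auto intro: primeideal_ideal)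
    then show ?thesis using Ps(2) ideal_prod_zero[OF idP] by simp
  next
    case False
    then obtain p where p: "p \<in> P" "p \<notin> P \<cdot> P" by blast
    have pc: "p \<in> carrier R" by (rule ideal.Icarr[OF idP p(1)])
    obtain Q Ps where Q: "primeideal Q R" "Q \<subseteq> P" "PIdl p = Q \<cdot> ideal_prod_list R Ps"
      and Ps: "\<And>Q. Q \<in> set Ps \<Longrightarrow> primeideal Q R" and L: "ideal (ideal_prod_list R Ps) R"
      by (rule zpi_factorE[OF z P cgenideal_ideal[OF pc] cgenideal_minimal[OF idP p(1)]]) metis
    have QP: "Q = P" using prime_cases[OF Q(1)] Q(2) M(2) by blast
    have Psid: "\<And>Q. Q \<in> set Ps \<Longrightarrow> ideal Q R" using Ps primeideal_ideal by blast
    \<comment> \<open>A second factor \<open>P\<close> would put \<open>p\<close> into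
      \<open>P \<cdot> P\<close>; so every remaining factor inside \<open>M\<close> is
      \<open>M\<close>, which \<open>P\<close> absorbs.\<close>
    have "Q' \<noteq> P" if "Q' \<in> set Ps" for Q'
    proof
      assume "Q' = P"
      then have "ideal_prod_list R Ps \<subseteq> P" using ideal_prod_list_le[OF Psid that] by blast
      then have "PIdl p \<subseteq> P \<cdot> P" using Q(3) QP ideal_prod_mono[of P P] by blast
      then show False using p(2) cgenideal_self[OF pc] by blast
    qed
    then have "locally_le R M P (Q' \<cdot> P)" if "Q' \<in> set Ps" "Q' \<subseteq> M" for Q'
      using prime_cases[OF Ps[OF that(1)] that(2)] PM that by blast
    then have "locally_le R M P (PIdl p)"
      unfolding Q(3) QP using Psid by (intro locally_le_prod_list M(1) idP)
    moreover have "locally_le R M (PIdl p) {\<zero>}"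
    proof -
      obtain s where s: "s \<in> carrier R - M" "s \<otimes> p = \<zero>"
        using zpi_smaller_prime_annihilated[OF z M(1) lp P M(2) p(1)] by blast
      have "s \<otimes> (c \<otimes> p) = \<zero>" if "c \<in> carrier R" for c
      proof -
        have "s \<otimes> (c \<otimes> p) = c \<otimes> (s \<otimes> p)" using s(1) pc that by (simp add: m_lcomm)
        then show ?thesis using s(2) that by simp
      qed
      then show ?thesis using s(1) by (auto simp: locally_le_def cgenideal_def)
    qed
    ultimately show ?thesis
      using locally_le_trans[OF M(1) ideal_subset_carrier[OF idP]] by blast
  qed
qed

lemma zpi_maximal_locally_principal:
  assumes z: "zpi_ring R" and nz: "\<one> \<noteq> \<zero>" and M: "maximalideal M R"
  shows "locally_principal R M"
proof -
  have pr: "primeideal M R" by (rule maximalideal_prime[OF M])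
  have idM: "ideal M R" by (rule primeideal_ideal[OF pr])
  \<comment> \<open>Either a smaller prime exists, or \<open>M\<close> is a minimal prime; in the
    latter case \<open>M\<close> is idempotent or has an element outside its square.\<close>
  consider P where "primeideal P R" "P \<subset> M"
    | "\<And>P. primeideal P R \<Longrightarrow> P \<subseteq> M \<Longrightarrow> P = M" "M \<subseteq> M \<cdot> M"
    | x where "\<And>P. primeideal P R \<Longrightarrow> P \<subseteq> M \<Longrightarrow> P = M" "x \<in> M" "x \<notin> M \<cdot> M"
    by blast
  then show ?thesis
  proof cases
    case 1
    then show ?thesis using zpi_larger_prime[OF z _ pr] by blast
  next
    case 2
    obtain Ps where Ps: "\<And>Q. Q \<in> set Ps \<Longrightarrow> primeideal Q R" "ideal_prod_list R Ps = {\<zero>}"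
      by (rule zpi_zero_factorE[OF z nz]) metis
    have "locally_le R M M (Q \<cdot> M)" if "Q \<in> set Ps" "Q \<subseteq> M" for Q
      using 2(1)[OF Ps(1)[OF that(1)] that(2)]
        locally_le_subset[OF pr ideal_prod_is_ideal[OF idM idM] 2(2)] by simp
    then have "locally_le R M M (M \<cdot> ideal_prod_list R Ps)"
      using Ps(1) by (intro locally_le_prod_list pr idM) (auto intro: primeideal_ideal)
    \<comment> \<open>Absorbing the factors of the zero ideal makes \<open>M\<close> locally zero,
      with \<open>\<zero>\<close> as local generator.\<close>
    then have "locally_le R M M {\<zero>}" using Ps(2) ideal_prod_zero[OF idM] by simp
    moreover have "PIdl \<zero> = {\<zero>}" using genideal_zero cgenideal_eq_genideal by simp
    ultimately show ?thesis unfolding locally_principal_def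
      by (intro bexI[of _ "\<zero>"] ideal_zero_mem[OF idM]) simp
  next
    case 3
    have xc: "x \<in> carrier R" by (rule ideal.Icarr[OF idM 3(2)])
    obtain Q Ps where Q: "primeideal Q R" "Q \<subseteq> M" "PIdl x = Q \<cdot> ideal_prod_list R Ps"
      and L: "ideal (ideal_prod_list R Ps) R"
      by (rule zpi_factorE[OF z pr cgenideal_ideal[OF xc] cgenideal_minimal[OF idM 3(2)]]) metis
    have QM: "Q = M" using 3(1) Q by blast
    \<comment> \<open>A cofactor inside \<open>M\<close> would put \<open>x\<close> into
      \<open>M \<cdot> M\<close>; hence \<open>PIdl x\<close> is locally \<open>M\<close>.\<close>
    have "\<not> ideal_prod_list R Ps \<subseteq> M"
      using ideal_prod_mono[of M M "ideal_prod_list R Ps" M R] Q(3) QM cgenideal_self[OF xc] 3(3)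
      by blast
    then have "locally_le R M M (ideal_prod_list R Ps \<cdot> M)"
      by (rule locally_le_prod_left[OF idM L])
    then show ?thesis
      unfolding locally_principal_def
      using Q(3) QM ideal_prod_commute[OF L idM] by (intro bexI[of _ x] 3(2)) simp
  qed
qed

section \<open>Finite generation\<close>

lemma Idl_insert:
  assumes "f \<in> carrier R" "F \<subseteq> carrier R"
  shows "Idl (insert f F) = PIdl f <+> Idl F"
proof
  have id: "ideal (PIdl f) R" "ideal (Idl F) R" "ideal (Idl (insert f F)) R"
    using assms by (auto intro!: cgenideal_ideal genideal_ideal)
  have "f \<in> PIdl f" "F \<subseteq> Idl F" using assms cgenideal_self genideal_self by auto
  then show "Idl (insert f F) \<subseteq> PIdl f <+> Idl F"
    using set_add_ge[OF id(1,2)] by (intro genideal_minimal add_ideals id) auto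
  have "insert f F \<subseteq> Idl (insert f F)" using assms by (intro genideal_self) auto
  then show "PIdl f <+> Idl F \<subseteq> Idl (insert f F)"
    by (intro set_add_le id cgenideal_minimal genideal_minimal) auto
qed

text \<open>Colon ideals extend the condition from generators to ideals:
  \<open>ideal_quot R K A\<close> is an ideal containing \<open>B\<close>, so it contains
  \<open>Idl B\<close>; then the same argument treats \<open>A\<close>.\<close>

lemma Idl_prod_le:
  assumes "A \<subseteq> carrier R" "B \<subseteq> carrier R" "ideal K R"
    and "\<And>a b. a \<in> A \<Longrightarrow> b \<in> B \<Longrightarrow> a \<otimes> b \<in> K"
  shows "(Idl A) \<cdot> (Idl B) \<subseteq> K"
proof -
  have idB: "ideal (Idl B) R" by (rule genideal_ideal[OF assms(2)])
  have swap: "a \<otimes> b = b \<otimes> a" if "a \<in> A" "b \<in> Idl B" for a b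
    using that assms(1) ideal.Icarr[OF idB that(2)] by (auto intro: m_comm)
  have 1: "a \<otimes> b \<in> K" if a: "a \<in> A" and b: "b \<in> Idl B" for a b
  proof -
    have "B \<subseteq> ideal_quot R K A"
    proof
      fix y assume y: "y \<in> B"
      have "y \<otimes> x \<in> K" if "x \<in> A" for x
        using assms(4)[OF that y] m_comm[of x y] that y assms(1,2) by (simp add: subset_iff)
      then show "y \<in> ideal_quot R K A" using y assms(2) by (auto simp: ideal_quot_def)
    qed
    then have "Idl B \<subseteq> ideal_quot R K A"
      by (rule genideal_minimal[OF ideal_quot_ideal[OF assms(3,1)]])
    then have "b \<otimes> a \<in> K" using a b by (auto simp: ideal_quot_def)
    then show ?thesis using swap[OF a b] by simp
  qed
  have "A \<subseteq> ideal_quot R K (Idl B)" using 1 assms(1) by (auto simp: ideal_quot_def)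
  then have "Idl A \<subseteq> ideal_quot R K (Idl B)"
    by (rule genideal_minimal[OF ideal_quot_ideal[OF assms(3) ideal_subset_carrier[OF idB]]])
  then show ?thesis by (intro ideal_prod_subsetI assms(3)) (auto simp: ideal_quot_def)
qed

lemma finitely_generated_prod:
  assumes "finite A" "A \<subseteq> carrier R" "finite B" "B \<subseteq> carrier R"
  shows "\<exists>C \<subseteq> carrier R. finite C \<and> (Idl A) \<cdot> (Idl B) = Idl C"
proof -
  define C where "C = (\<lambda>(a, b). a \<otimes> b) ` (A \<times> B)"
  have C: "C \<subseteq> carrier R" "finite C" using assms by (auto simp: C_def)
  have idA: "ideal (Idl A) R" and idB: "ideal (Idl B) R" and idC: "ideal (Idl C) R"
    using assms C by (auto intro!: genideal_ideal)
  have "(Idl A) \<cdot> (Idl B) \<subseteq> Idl C"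
    using genideal_self[OF C(1)] by (intro Idl_prod_le assms idC) (auto simp: C_def)
  moreover have "C \<subseteq> (Idl A) \<cdot> (Idl B)"
    using genideal_self[OF assms(2)] genideal_self[OF assms(4)]
    by (auto simp: C_def intro!: ideal_prod.prod)
  then have "Idl C \<subseteq> (Idl A) \<cdot> (Idl B)"
    by (rule genideal_minimal[OF ideal_prod_is_ideal[OF idA idB]])
  ultimately show ?thesis using C by blast
qed

lemma finitely_generated_prod_list:
  assumes "\<And>H. H \<in> set Hs \<Longrightarrow> \<exists>A \<subseteq> carrier R. finite A \<and> H = Idl A"
  shows "\<exists>A \<subseteq> carrier R. finite A \<and> ideal_prod_list R Hs = Idl A"
  using assms
proof (induction Hs)
  case Nil
  then show ?case using genideal_one by (intro exI[of _ "{\<one>}"]) auto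
next
  case (Cons H Hs)
  then obtain A B where "A \<subseteq> carrier R" "finite A" "H = Idl A"
    "B \<subseteq> carrier R" "finite B" "ideal_prod_list R Hs = Idl B"
    by (metis list.set_intros)
  then show ?case using finitely_generated_prod[of A B] by simp
qed

text \<open>If \<open>s\<close> is the local multiplier and
  \<open>\<one> = r \<otimes> s \<oplus> e\<close> with \<open>e\<close> in \<open>M\<close>, then
  \<open>m = r \<otimes> (s \<otimes> m) \<oplus> m \<otimes> e\<close>, so \<open>x\<close> and
  \<open>e\<close> generate \<open>M\<close>.\<close>

lemma maximal_locally_principal_finitely_generated:
  assumes M: "maximalideal M R" "locally_principal R M"
  shows "\<exists>A \<subseteq> carrier R. finite A \<and> M = Idl A"
proof -
  have pr: "primeideal M R" by (rule maximalideal_prime[OF M(1)])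
  have idM: "ideal M R" by (rule primeideal_ideal[OF pr])
  obtain x s where x: "x \<in> M" "x \<in> carrier R" "s \<in> carrier R" "s \<notin> M"
    and s: "\<And>m. m \<in> M \<Longrightarrow> \<exists>c\<in>carrier R. s \<otimes> m = c \<otimes> x"
    by (rule locally_principalE[OF M(2) pr]) metis
  obtain r e where re: "r \<in> carrier R" "e \<in> M" "\<one> = r \<otimes> s \<oplus> e"
    by (rule maximalideal_cases[OF M(1) x(3,4)])
  have ec: "e \<in> carrier R" by (rule ideal.Icarr[OF idM re(2)])
  have id: "ideal (Idl {x, e}) R" using x ec by (intro genideal_ideal) auto
  have xe: "x \<in> Idl {x, e}" "e \<in> Idl {x, e}" using genideal_self[of "{x, e}"] x ec by auto
  have "m \<in> Idl {x, e}" if m: "m \<in> M" for m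
  proof -
    have mc: "m \<in> carrier R" by (rule ideal.Icarr[OF idM m])
    obtain c where c: "c \<in> carrier R" "s \<otimes> m = c \<otimes> x" using s[OF m] by blast
    have "m = (r \<otimes> s \<oplus> e) \<otimes> m" unfolding re(3)[symmetric] using mc by simp
    also have "\<dots> = r \<otimes> (s \<otimes> m) \<oplus> m \<otimes> e" using re(1) x(3) ec mc by algebra
    also have "\<dots> = (r \<otimes> c) \<otimes> x \<oplus> m \<otimes> e" unfolding c(2) using re(1) c(1) x(2) by (simp add: m_assoc)
    also have "\<dots> \<in> Idl {x, e}"
      using re(1) c(1) mc by (intro ideal_add_mem[OF id] ideal.I_l_closed[OF id] xe) auto
    finally show ?thesis .
  qed
  then have "M = Idl {x, e}" using genideal_minimal[OF idM, of "{x, e}"] x re by blast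
  then show ?thesis using x ec by (intro exI[of _ "{x, e}"]) auto
qed

text \<open>By hypothesis no maximal ideal contains both \<open>P\<close> and its annihilator, so
  \<open>\<one> = e \<oplus> a\<close> with \<open>e\<close> in \<open>P\<close> and
  \<open>a\<close> annihilating \<open>P\<close>. Then \<open>p = p \<otimes> e\<close> for all
  \<open>p\<close> in \<open>P\<close>; in particular \<open>e\<close> is idempotent.\<close>

lemma locally_zero_principal:
  assumes P: "ideal P R" and z: "\<And>M. maximalideal M R \<Longrightarrow> P \<subseteq> M \<Longrightarrow> locally_le R M P {\<zero>}"
  shows "\<exists>e\<in>P. P = PIdl e"
proof -
  let ?A = "ideal_quot R {\<zero>} P"
  have A: "ideal ?A R" by (rule ideal_quot_ideal[OF zeroideal ideal_subset_carrier[OF P]])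
  have "P <+> ?A = carrier R"
  proof (rule ccontr)
    assume "\<not> ?thesis"
    then obtain M where M: "maximalideal M R" "P <+> ?A \<subseteq> M"
      using exists_maximalideal[of "P <+> ?A"] add_ideals[OF P A] by (auto simp: proper_ideal_def)
    then have sub: "P \<subseteq> M" "?A \<subseteq> M" using set_add_ge[OF P A] by auto
    show False using z[OF M(1) sub(1)] sub(2) by (auto simp: locally_le_def ideal_quot_def)
  qed
  then have "\<one> \<in> P <+> ?A" by simp
  then obtain e a where ea: "e \<in> P" "a \<in> ?A" "\<one> = e \<oplus> a" by (rule set_add_memE)
  have c: "e \<in> carrier R" "a \<in> carrier R" using ideal.Icarr[OF P ea(1)] ideal.Icarr[OF A ea(2)] .
  have "p \<in> PIdl e" if p: "p \<in> P" for p
  proof -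
    have pc: "p \<in> carrier R" by (rule ideal.Icarr[OF P p])
    have "p = (e \<oplus> a) \<otimes> p" unfolding ea(3)[symmetric] using pc by simp
    also have "\<dots> = p \<otimes> e \<oplus> a \<otimes> p" using c pc by algebra
    also have "\<dots> = p \<otimes> e" using ea(2) p c pc by (simp add: ideal_quot_def)
    finally show ?thesis using pc by (auto simp: cgenideal_def)
  qed
  then show ?thesis using cgenideal_minimal[OF P ea(1)] ea(1) by blast
qed

theorem zpi_imp_noetherian:
  assumes z: "zpi_ring R" and nz: "\<one> \<noteq> \<zero>"
  shows "noetherian_ring R"
proof (rule noetherian_ringI)
  have pr: "\<exists>A \<subseteq> carrier R. finite A \<and> P = Idl A" if P: "primeideal P R" for P
  proof (cases "maximalideal P R")
    case True
    then show ?thesis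
      using maximal_locally_principal_finitely_generated zpi_maximal_locally_principal[OF z nz] by blast
  next
    case False
    have idP: "ideal P R" by (rule primeideal_ideal[OF P])
    have "locally_le R M P {\<zero>}" if "maximalideal M R" "P \<subseteq> M" for M
    proof -
      have "P \<noteq> M" using that False by blast
      then show ?thesis
        using zpi_nonmaximal_prime_locally_zero[OF z nz P maximalideal_prime[OF that(1)]] that(2)
        by blast
    qed
    then obtain e where "e \<in> P" "P = PIdl e" using locally_zero_principal[OF idP] by blast
    then have "e \<in> carrier R" "P = Idl {e}"
      using ideal.Icarr[OF idP] cgenideal_eq_genideal by auto
    then show ?thesis by (intro exI[of _ "{e}"]) auto
  qed
  fix I assume I: "ideal I R"
  show "\<exists>A \<subseteq> carrier R. finite A \<and> I = Idl A"
  proof (cases "I = carrier R")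
    case True
    then show ?thesis using genideal_one by (intro exI[of _ "{\<one>}"]) auto
  next
    case False
    then obtain Ps where "\<forall>P\<in>set Ps. primeideal P R" "I = ideal_prod_list R Ps"
      using z I by (auto simp: zpi_ring_def proper_ideal_def)
    then show ?thesis using finitely_generated_prod_list[of Ps] pr by simp
  qed
qed

end

section \<open>Noetherian rings with radical factors\<close>

text \<open>The part of the strongly ISP property that the Noetherian argument uses: one radical
  factor is kept, and \<open>J\<close> takes in the invertible ideal and all other factors.\<close>

definition radical_divisor_ring :: "('a, 'b) ring_scheme \<Rightarrow> bool" where
  "radical_divisor_ring R \<longleftrightarrow>
    (\<forall>I. proper_ideal I R \<longrightarrow> (\<exists>J H. ideal J R \<and> radical_ideal H R \<and> I = J \<cdot>\<^bsub>R\<^esub> H))"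

context cring
begin

text \<open>Induction on the generating set. In
  \<open>s \<otimes> f = l \<oplus> m \<otimes> f\<close> with \<open>m\<close> in \<open>M\<close>,
  the last term moves to the left, and \<open>s \<ominus> m\<close> sends \<open>f\<close> into
  \<open>K <+> M \<cdot> (Idl F)\<close>. With \<open>f\<close> eliminated on the right, the
  induction hypothesis applies to \<open>F\<close>.\<close>

lemma locally_le_nakayama:
  assumes M: "primeideal M R" and K: "ideal K R" and "finite F" "F \<subseteq> carrier R"
    and "locally_le R M (Idl F) (K <+> M \<cdot> (Idl F))"
  shows "locally_le R M (Idl F) K"
  using assms(3-5)
proof (induction F)
  case empty
  have "Idl {} \<subseteq> K" by (rule genideal_minimal[OF K]) simp
  then show ?case by (rule locally_le_subset[OF M K])
next
  case (insert f F)
  have idM: "ideal M R" by (rule primeideal_ideal[OF M])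
  have F: "F \<subseteq> carrier R" "f \<in> carrier R" using insert.prems by auto
  have idf: "ideal (PIdl f) R" and idF: "ideal (Idl F) R"
    using F by (auto intro: cgenideal_ideal genideal_ideal)
  have eq: "Idl (insert f F) = PIdl f <+> Idl F" by (rule Idl_insert[OF F(2,1)])
  have idG: "ideal (PIdl f <+> Idl F) R" by (rule add_ideals[OF idf idF])
  let ?L = "K <+> M \<cdot> (Idl F)"
  have MF: "ideal (M \<cdot> (Idl F)) R" by (rule ideal_prod_is_ideal[OF idM idF])
  have L: "ideal ?L R" by (rule add_ideals[OF K MF])
  have Mf: "ideal (M \<cdot> (PIdl f)) R" by (rule ideal_prod_is_ideal[OF idM idf])
  have LM: "ideal (?L <+> M \<cdot> (PIdl f)) R" by (rule add_ideals[OF L Mf])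
  have "M \<cdot> (PIdl f <+> Idl F) \<subseteq> ?L <+> M \<cdot> (PIdl f)"
    unfolding ideal_prod_r_distr[OF idM idf idF]
    using set_add_ge[OF L Mf] set_add_ge[OF K MF] by (intro set_add_le LM) auto
  then have "K <+> M \<cdot> (PIdl f <+> Idl F) \<subseteq> ?L <+> M \<cdot> (PIdl f)"
    using set_add_ge[OF L Mf] set_add_ge[OF K MF] by (intro set_add_le LM) auto
  then have 1: "locally_le R M (PIdl f <+> Idl F) (?L <+> M \<cdot> (PIdl f))"
    using insert.prems(2) unfolding eq locally_le_def by blast
  have "f \<in> PIdl f <+> Idl F" using set_add_ge[OF idf idF] cgenideal_self[OF F(2)] by blast
  then obtain s where s: "s \<in> carrier R" "s \<notin> M" "s \<otimes> f \<in> ?L <+> M \<cdot> (PIdl f)"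
    using 1 by (auto simp: locally_le_def)
  then obtain l z where lz: "l \<in> ?L" "z \<in> M \<cdot> (PIdl f)" "s \<otimes> f = l \<oplus> z"
    by (auto elim: set_add_memE)
  obtain m where m: "m \<in> M" "z = m \<otimes> f" using ideal_prod_cgenidealE[OF lz(2) idM F(2)] by blast
  have c: "m \<in> carrier R" "l \<in> carrier R"
    using ideal.Icarr[OF idM m(1)] ideal.Icarr[OF L lz(1)] .
  have "(s \<ominus> m) \<otimes> f = s \<otimes> f \<ominus> m \<otimes> f" using c s(1) F(2) by algebra
  also have "\<dots> = l" unfolding lz(3) m(2) using c F(2) by algebra
  finally have sm: "(s \<ominus> m) \<otimes> f \<in> ?L" using lz(1) by simp
  note t = prime_minus_notin[OF M s(1,2) m(1)]
  have "(s \<ominus> m) \<otimes> (r \<otimes> f) \<in> ?L" if "r \<in> carrier R" for r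
    using ideal.I_l_closed[OF L sm that] t(1) that F(2) by (simp add: m_lcomm)
  then have f: "locally_le R M (PIdl f) ?L"
    using t unfolding locally_le_def cgenideal_def by blast
  have "locally_le R M (M \<cdot> (PIdl f)) ?L"
    using f ideal_prod_le(2)[OF idM idf] unfolding locally_le_def by blast
  then have "locally_le R M (?L <+> M \<cdot> (PIdl f)) ?L"
    by (rule locally_le_add[OF M L Mf L locally_le_subset[OF M L order_refl]])
  then have 2: "locally_le R M (PIdl f <+> Idl F) ?L"
    using locally_le_trans[OF M ideal_subset_carrier[OF idG] 1] by blast
  have "locally_le R M (Idl F) ?L"
    using 2 set_add_ge(2)[OF idf idF] unfolding locally_le_def by blast
  then have "locally_le R M (Idl F) K" by (rule insert.IH[OF F(1)])
  then have "locally_le R M (M \<cdot> (Idl F)) K"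
    using ideal_prod_le(2)[OF idM idF] unfolding locally_le_def by blast
  then have "locally_le R M ?L K"
    by (rule locally_le_add[OF M K MF K locally_le_subset[OF M K order_refl]])
  then show ?case
    unfolding eq by (rule locally_le_trans[OF M ideal_subset_carrier[OF idG] 2])
qed

end

section \<open>Maximal elements and associated primes\<close>

lemma (in noetherian_ring) exists_maximal_element:
  assumes "S \<subseteq> {I. ideal I R}" "S \<noteq> {}"
  obtains J where "J \<in> S" "\<And>K. K \<in> S \<Longrightarrow> J \<subseteq> K \<Longrightarrow> K = J"
proof -
  have "\<exists>U\<in>S. \<forall>X\<in>C. X \<subseteq> U" if C: "subset.chain S C" for C
  proof (cases "C = {}")
    case True
    then show ?thesis using assms(2) by auto
  next
    case False
    have "subset.chain {I. ideal I R} C" using C assms(1) by (auto simp: pred_on.chain_def)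
    then have "\<Union>C \<in> C" using False by (rule ideal_chain_is_trivial[rotated])
    then show ?thesis using C by (auto simp: pred_on.chain_def)
  qed
  then show ?thesis using subset_Zorn[of S] that by metis
qed

context cring
begin

text \<open>A maximal member among the colon ideals \<open>(I : a)\<close> with \<open>a\<close>
  outside \<open>I\<close> is prime. The element \<open>a\<close> shows that \<open>(I : P)\<close>
  is larger than \<open>I\<close>, which drives the Noetherian induction.\<close>

lemma exists_associated_prime:
  assumes "noetherian_ring R" "proper_ideal I R"
  obtains P a where "primeideal P R" "I \<subseteq> P" "a \<in> carrier R" "a \<notin> I" "a \<in> ideal_quot R I P"
proof -
  interpret noetherian_ring R by fact
  have I: "ideal I R" "\<one> \<notin> I" using assms(2) proper_ideal_iff_one by (auto simp: proper_ideal_def)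
  define S where "S = (\<lambda>a. ideal_quot R I {a}) ` (carrier R - I)"
  have "S \<noteq> {}" using I(2) by (auto simp: S_def)
  moreover have "S \<subseteq> {I. ideal I R}" using ideal_quot_ideal[OF I(1)] by (auto simp: S_def)
  ultimately obtain P where P: "P \<in> S" "\<And>K. K \<in> S \<Longrightarrow> P \<subseteq> K \<Longrightarrow> K = P"
    using exists_maximal_element by metis
  then obtain a where a: "a \<in> carrier R" "a \<notin> I" "P = ideal_quot R I {a}" by (auto simp: S_def)
  have idP: "ideal P R" unfolding a(3) using ideal_quot_ideal[OF I(1)] a(1) by simp
  have "primeideal P R"
  proof (rule primeidealI[OF idP is_cring])
    show "carrier R \<noteq> P" using a proper_ideal_iff_one[OF idP] by (auto simp: ideal_quot_def)
  next
    fix b c assume bc: "b \<in> carrier R" "c \<in> carrier R" "b \<otimes> c \<in> P"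
    show "b \<in> P \<or> c \<in> P"
    proof (cases "c \<in> P")
      case False
      \<comment> \<open>For \<open>c\<close> outside \<open>P\<close>, the ideal
        \<open>(I : c \<otimes> a)\<close> is in the family and contains \<open>P\<close>, so it
        equals \<open>P\<close> by maximality; and it contains \<open>b\<close>.\<close>
      then have ca: "c \<otimes> a \<in> carrier R - I" using a bc by (auto simp: ideal_quot_def)
      have "P \<subseteq> ideal_quot R I {c \<otimes> a}"
      proof
        fix p assume "p \<in> P"
        then have p: "p \<in> carrier R" "p \<otimes> a \<in> I" by (auto simp: a(3) ideal_quot_def)
        have "p \<otimes> (c \<otimes> a) = c \<otimes> (p \<otimes> a)" using p(1) bc a(1) by (simp add: m_lcomm)
        then show "p \<in> ideal_quot R I {c \<otimes> a}"
          using p ideal.I_l_closed[OF I(1) p(2) bc(2)] by (simp add: ideal_quot_def)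
      qed
      then have "ideal_quot R I {c \<otimes> a} = P" using ca by (intro P(2)) (auto simp: S_def)
      moreover have "b \<in> ideal_quot R I {c \<otimes> a}"
        using bc a by (simp add: ideal_quot_def m_assoc)
      ultimately show ?thesis by simp
    qed simp
  qed
  moreover have "I \<subseteq> P" using ideal_quot_ge[OF I(1), of "{a}"] a by simp
  moreover have "a \<in> ideal_quot R I P"
    using a(1) m_comm by (auto simp: a(3) ideal_quot_def)
  ultimately show ?thesis using that a by blast
qed

text \<open>In \<open>I = J \<cdot> H\<close> the radical ideal \<open>H\<close> contains
  \<open>M \<cdot> M\<close>, hence \<open>M\<close>, and so equals \<open>M\<close>. As
  \<open>I\<close> is not inside \<open>M \<cdot> M\<close>, \<open>J\<close> is not inside
  \<open>M\<close>; since \<open>J\<close> contains \<open>M \<cdot> M\<close>, it is the whole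
  ring.\<close>

lemma no_ideal_between_square:
  assumes rd: "radical_divisor_ring R" and M: "maximalideal M R"
    and I: "ideal I R" "M \<cdot> M \<subseteq> I" "I \<subseteq> M" "\<not> I \<subseteq> M \<cdot> M"
  shows "I = M"
proof -
  have pr: "primeideal M R" by (rule maximalideal_prime[OF M])
  have idM: "ideal M R" by (rule primeideal_ideal[OF pr])
  have "proper_ideal I R" using I primeideal_one[OF pr] by (auto simp: proper_ideal_def)
  then obtain J H where JH: "ideal J R" "radical_ideal H R" "I = J \<cdot> H"
    using rd by (auto simp: radical_divisor_ring_def)
  have H: "proper_ideal H R" "ideal H R" "ideal_radical R H = H"
    using JH(2) by (auto simp: radical_ideal_def proper_ideal_def)
  have IH: "I \<subseteq> J" "I \<subseteq> H" using ideal_prod_le[OF JH(1) H(2)] JH(3) by auto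
  have "M \<subseteq> H"
  proof
    fix m assume m: "m \<in> M"
    have mc: "m \<in> carrier R" by (rule ideal.Icarr[OF idM m])
    have "m [^] (2::nat) = m \<otimes> m" using mc by (simp add: numeral_2_eq_2)
    then have "m [^] (2::nat) \<in> H" using ideal_prod.prod[OF m m, of R] I(2) IH(2) by auto
    then have "m \<in> ideal_radical R H" using mc by (auto simp: ideal_radical_def intro!: exI[of _ 2])
    then show "m \<in> H" using H(3) by simp
  qed
  then have HM: "H = M" by (rule maximalideal_max[OF M H(1)])
  have "\<not> J \<subseteq> M" using I(4) JH(3) HM ideal_prod_mono[of J M M M] by blast
  then obtain j where j: "j \<in> J" "j \<notin> M" by blast
  have jc: "j \<in> carrier R" by (rule ideal.Icarr[OF JH(1) j(1)])
  obtain r m where rm: "r \<in> carrier R" "m \<in> M" "\<one> = r \<otimes> j \<oplus> m"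
    by (rule maximalideal_cases[OF M jc j(2)])
  have mc: "m \<in> carrier R" by (rule ideal.Icarr[OF idM rm(2)])
  \<comment> \<open>Squaring the relation leaves a multiple of \<open>j\<close> and the term
    \<open>m \<otimes> m\<close>, which lies in \<open>M \<cdot> M \<subseteq> J\<close>.\<close>
  have "\<one> = (r \<otimes> j \<oplus> m) \<otimes> (r \<otimes> j \<oplus> m)" unfolding rm(3)[symmetric] by simp
  also have "\<dots> = (r \<otimes> (r \<otimes> j) \<oplus> r \<otimes> m \<oplus> m \<otimes> r) \<otimes> j \<oplus> m \<otimes> m"
    using rm(1) jc mc by algebra
  also have "\<dots> \<in> J"
    using ideal_prod.prod[OF rm(2,2), of R] I(2) IH(1) rm(1) jc mc
    by (intro ideal_add_mem[OF JH(1)] ideal.I_l_closed[OF JH(1) j(1)]) auto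
  finally have "J = carrier R" using ideal.one_imp_carrier[OF JH(1)] by simp
  then show ?thesis using JH(3) HM ideal_prod_one[OF idM] ideal_prod_commute[OF idM oneideal] by simp
qed

text \<open>Modulo its square \<open>M\<close> is generated by any \<open>x\<close> outside
  \<open>M \<cdot> M\<close>, or by \<open>\<zero>\<close> if \<open>M = M \<cdot> M\<close>;
  Nakayama's lemma turns this into a local generator.\<close>

lemma noetherian_maximal_locally_principal:
  assumes "noetherian_ring R" and rd: "radical_divisor_ring R" and M: "maximalideal M R"
  shows "locally_principal R M"
proof -
  interpret noetherian_ring R by fact
  have pr: "primeideal M R" by (rule maximalideal_prime[OF M])
  have idM: "ideal M R" by (rule primeideal_ideal[OF pr])
  have idMM: "ideal (M \<cdot> M) R" by (rule ideal_prod_is_ideal[OF idM idM])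
  obtain F where F: "F \<subseteq> carrier R" "finite F" "M = Idl F" using finetely_gen[OF idM] by blast
  obtain x where x: "x \<in> M" "M \<subseteq> PIdl x <+> M \<cdot> M"
  proof (cases "M \<subseteq> M \<cdot> M")
    case True
    have "M \<cdot> M \<subseteq> PIdl \<zero> <+> M \<cdot> M"
      by (rule set_add_ge(2)[OF cgenideal_ideal[OF zero_closed] idMM])
    then show ?thesis using that[of "\<zero>"] True ideal_zero_mem[OF idM] by blast
  next
    case False
    then obtain x where x: "x \<in> M" "x \<notin> M \<cdot> M" by blast
    have xc: "x \<in> carrier R" by (rule ideal.Icarr[OF idM x(1)])
    have idx: "ideal (PIdl x) R" by (rule cgenideal_ideal[OF xc])
    have "PIdl x <+> M \<cdot> M \<subseteq> M"
      by (intro set_add_le idM cgenideal_minimal x ideal_prod_le)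
    moreover have "x \<in> PIdl x <+> M \<cdot> M"
      using set_add_ge(1)[OF idx idMM] cgenideal_self[OF xc] by blast
    ultimately have "PIdl x <+> M \<cdot> M = M"
      using no_ideal_between_square[OF rd M add_ideals[OF idx idMM] set_add_ge(2)[OF idx idMM]] x(2)
      by blast
    then show ?thesis using that[OF x(1)] by simp
  qed
  have idx: "ideal (PIdl x) R" by (rule cgenideal_ideal[OF ideal.Icarr[OF idM x(1)]])
  have "locally_le R M M (PIdl x <+> M \<cdot> M)"
    by (rule locally_le_subset[OF pr add_ideals[OF idx idMM] x(2)])
  then have "locally_le R M M (PIdl x)"
    using locally_le_nakayama[OF pr idx F(2,1)] F(3) by simp
  then show ?thesis using x(1) by (auto simp: locally_principal_def)
qed

text \<open>Locally \<open>P = M \<cdot> P\<close>, and \<open>P\<close> is finitely generated, so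
  Nakayama's lemma with \<open>K = {\<zero>}\<close> applies.\<close>

lemma noetherian_nonmaximal_prime_locally_zero:
  assumes "noetherian_ring R" "primeideal M R" "locally_principal R M" "primeideal P R" "P \<subset> M"
  shows "locally_le R M P {\<zero>}"
proof -
  interpret noetherian_ring R by fact
  have idP: "ideal P R" and idM: "ideal M R" using assms primeideal_ideal by blast+
  obtain F where F: "F \<subseteq> carrier R" "finite F" "P = Idl F" using finetely_gen[OF idP] by blast
  have "M \<cdot> P \<subseteq> {\<zero>} <+> M \<cdot> P"
    by (rule set_add_ge(2)[OF zeroideal ideal_prod_is_ideal[OF idM idP]])
  then have "locally_le R M P ({\<zero>} <+> M \<cdot> P)"
    using locally_principal_smaller_prime[OF assms(2-5)] unfolding locally_le_def by blast
  then show ?thesis using locally_le_nakayama[OF assms(2) zeroideal F(2,1)] F(3) by simp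
qed

text \<open>The nontrivial inclusion is checked at each maximal ideal \<open>M\<close>:
  \<open>P\<close> is locally the unit ideal if it is not inside \<open>M\<close>, locally principal
  if it equals \<open>M\<close>, and locally zero, together with \<open>I\<close>, if it is
  smaller.\<close>

lemma prime_ideal_quot_factor:
  assumes no: "noetherian_ring R" and rd: "radical_divisor_ring R"
    and P: "primeideal P R" and I: "ideal I R" "I \<subseteq> P"
  shows "I = P \<cdot> ideal_quot R I P"
proof
  let ?J = "ideal_quot R I P"
  have idP: "ideal P R" by (rule primeideal_ideal[OF P])
  have J: "ideal ?J R" by (rule ideal_quot_ideal[OF I(1) ideal_subset_carrier[OF idP]])
  have PJ: "ideal (P \<cdot> ?J) R" by (rule ideal_prod_is_ideal[OF idP J])
  show "P \<cdot> ?J \<subseteq> I" by (rule ideal_prod_quot_le[OF I(1) idP])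
  show "I \<subseteq> P \<cdot> ?J"
  proof (rule local_global[OF I(1) PJ])
    fix M assume M: "maximalideal M R"
    have pr: "primeideal M R" by (rule maximalideal_prime[OF M])
    have lp: "locally_principal R M" by (rule noetherian_maximal_locally_principal[OF no rd M])
    consider "\<not> P \<subseteq> M" | "P = M" | "P \<subset> M" by blast
    then show "locally_le R M I (P \<cdot> ?J)"
    proof cases
      case 1
      have "P \<cdot> I \<subseteq> P \<cdot> ?J"
        using ideal_quot_ge[OF I(1) ideal_subset_carrier[OF idP]] by (intro ideal_prod_mono) auto
      then show ?thesis using locally_le_prod_left[OF I(1) idP 1] unfolding locally_le_def by blast
    next
      case 2
      then show ?thesis using locally_principal_quot[OF pr lp I(1)] I(2) by simp
    next
      case 3
      then have "locally_le R M P {\<zero>}"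
        by (rule noetherian_nonmaximal_prime_locally_zero[OF no pr lp P])
      then obtain s where "s \<in> carrier R - M" "\<forall>x\<in>P. s \<otimes> x = \<zero>" by (auto simp: locally_le_def)
      then show ?thesis
        using I(2) ideal_zero_mem[OF PJ] unfolding locally_le_def
        by (intro bexI[of _ s]) (auto simp: subset_iff)
    qed
  qed
qed

text \<open>A maximal counterexample \<open>I\<close> equals \<open>P \<cdot> (I : P)\<close> for an
  associated prime \<open>P\<close>. The colon ideal is strictly larger, so it factors, and
  \<open>I\<close> with it.\<close>

theorem noetherian_imp_zpi:
  assumes no: "noetherian_ring R" and rd: "radical_divisor_ring R"
  shows "zpi_ring R"
proof (rule ccontr)
  interpret noetherian_ring R by fact
  define S where "S = {I. proper_ideal I R \<and>
    \<not> (\<exists>Ps. Ps \<noteq> [] \<and> (\<forall>P\<in>set Ps. primeideal P R) \<and> I = ideal_prod_list R Ps)}"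
  assume "\<not> zpi_ring R"
  then have "S \<noteq> {}" by (auto simp: zpi_ring_def S_def)
  moreover have "S \<subseteq> {I. ideal I R}" by (auto simp: S_def proper_ideal_def)
  ultimately obtain I where I: "I \<in> S" "\<And>K. K \<in> S \<Longrightarrow> I \<subseteq> K \<Longrightarrow> K = I"
    using exists_maximal_element by metis
  have pI: "proper_ideal I R" "ideal I R" using I(1) by (auto simp: S_def proper_ideal_def)
  obtain P a where P: "primeideal P R" "I \<subseteq> P" and a: "a \<notin> I" "a \<in> ideal_quot R I P"
    using exists_associated_prime[OF no pI(1)] by metis
  have idP: "ideal P R" by (rule primeideal_ideal[OF P(1)])
  let ?J = "ideal_quot R I P"
  have eq: "I = P \<cdot> ?J" by (rule prime_ideal_quot_factor[OF no rd P(1) pI(2) P(2)])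
  have "?J \<notin> S" using I(2)[of ?J] ideal_quot_ge[OF pI(2) ideal_subset_carrier[OF idP]] a by auto
  moreover have "ideal ?J R" by (rule ideal_quot_ideal[OF pI(2) ideal_subset_carrier[OF idP]])
  ultimately have "?J = carrier R \<or> (\<exists>Ps. (\<forall>P\<in>set Ps. primeideal P R) \<and> ?J = ideal_prod_list R Ps)"
    unfolding S_def proper_ideal_def by blast
  then obtain Ps where "\<forall>P\<in>set Ps. primeideal P R" "?J = ideal_prod_list R Ps"
    by (metis empty_iff ideal_prod_list_Nil list.set(1))
  then have "I = ideal_prod_list R (P # Ps)" "\<forall>Q\<in>set (P # Ps). primeideal Q R"
    using eq P(1) by auto
  then show False using I(1) unfolding S_def by blast
qed

end

section \<open>The equivalence\<close>

context cring
begin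

lemma prime_imp_radical_ideal:
  assumes "primeideal P R" shows "radical_ideal P R"
proof -
  have "x \<in> P" if "x \<in> carrier R" "x [^] n \<in> P" for x and n :: nat
    using that(2)
  proof (induction n)
    case 0
    then show ?case using primeideal_one[OF assms] by simp
  next
    case (Suc n)
    then show ?case using primeideal.I_prime[OF assms, of "x [^] n" x] that(1) by auto
  qed
  moreover have "x [^] (1::nat) \<in> P" if "x \<in> P" for x
    using that ideal.Icarr[OF primeideal_ideal[OF assms]] by simp
  ultimately show ?thesis
    using primeideal_proper[OF assms] ideal.Icarr[OF primeideal_ideal[OF assms]]
    unfolding radical_ideal_def ideal_radical_def by blast
qed

lemma zpi_imp_ssp: "zpi_ring R \<Longrightarrow> ssp_ring R"
  unfolding zpi_ring_def ssp_ring_def using prime_imp_radical_ideal by metis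

lemma strongly_isp_imp_radical_divisor:
  assumes "strongly_isp_ring R"
  shows "radical_divisor_ring R"
  unfolding radical_divisor_ring_def
proof (intro allI impI)
  fix I assume "proper_ideal I R"
  then obtain J Hs where J: "invertible_ideal J R" "Hs \<noteq> []" "\<forall>H\<in>set Hs. radical_ideal H R"
    "I = J \<cdot> ideal_prod_list R Hs"
    using assms by (auto simp: strongly_isp_ring_def)
  obtain H Ks where Hs: "Hs = H # Ks" using J(2) by (cases Hs) auto
  have id: "\<And>H. H \<in> set Hs \<Longrightarrow> ideal H R" "ideal J R"
    using J by (auto simp: radical_ideal_def proper_ideal_def invertible_ideal_def)
  then have K: "ideal (ideal_prod_list R Ks) R" "ideal H R"
    using Hs by (auto intro: ideal_prod_list_ideal)
  have "I = J \<cdot> ideal_prod_list R Ks \<cdot> H"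
    using J(4) Hs K id(2) by (simp add: ideal_prod_assoc ideal_prod_commute[of H])
  then show "\<exists>J H. ideal J R \<and> radical_ideal H R \<and> I = J \<cdot> H"
    using J(3) Hs ideal_prod_is_ideal[OF id(2) K(1)] by auto
qed

text \<open>The inverse is the copy of \<open>R\<close> inside its total quotient ring. This
  supplies the invertible factor when an SSP factorisation is read as a strongly ISP one.\<close>

lemma carrier_invertible: "invertible_ideal (carrier R) R"
proof -
  let ?T = "total_quotient R" and ?B = "base_in_total_quotient R"
  interpret T: algebra R ?T by (rule total_quotient_algebra)
  have sub: "subgroup ?B (add_monoid ?T)"
  proof (rule T.M.add.subgroupI)
    show "?B \<subseteq> carrier ?T"
      by (auto simp: base_in_total_quotient_def total_quotient_simps)
    show "?B \<noteq> {}" by (auto simp: base_in_total_quotient_def)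
  next
    fix x assume "x \<in> ?B"
    then obtain a where a: "a \<in> carrier R" "x = quot_frac R a \<one>"
      by (auto simp: base_in_total_quotient_def)
    have "quot_frac R (\<ominus> a) \<one> \<oplus>\<^bsub>?T\<^esub> x = \<zero>\<^bsub>?T\<^esub>"
      using a by (simp add: total_quotient_simps l_neg)
    then have "\<ominus>\<^bsub>?T\<^esub> x = quot_frac R (\<ominus> a) \<one>"
      using a by (intro T.M.minus_equality) (auto simp: total_quotient_simps)
    then show "\<ominus>\<^bsub>?T\<^esub> x \<in> ?B" using a by (auto simp: base_in_total_quotient_def)
  next
    fix x y assume "x \<in> ?B" "y \<in> ?B"
    then show "x \<oplus>\<^bsub>?T\<^esub> y \<in> ?B"
      by (auto simp: base_in_total_quotient_def total_quotient_simps)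
  qed
  have smult: "a \<odot>\<^bsub>?T\<^esub> x \<in> ?B" if "a \<in> carrier R" "x \<in> ?B" for a x
    using that by (auto simp: base_in_total_quotient_def total_quotient_simps)
  have "submodule ?B R ?T"
    using sub smult by (simp add: submodule_def submodule_axioms_def)
  moreover have "ideal_smult R (carrier R) ?B = ?B"
  proof
    show "ideal_smult R (carrier R) ?B \<subseteq> ?B"
      unfolding ideal_smult_def using smult by (intro T.M.add.generate_subgroup_incl sub) auto
    show "?B \<subseteq> ideal_smult R (carrier R) ?B"
    proof
      fix x assume x: "x \<in> ?B"
      then have "x \<in> carrier ?T" using subgroup.subset[OF sub] by auto
      then have "x = \<one> \<odot>\<^bsub>?T\<^esub> x" by simp
      then show "x \<in> ideal_smult R (carrier R) ?B"
        unfolding ideal_smult_def using x by (intro generate.incl) blast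
    qed
  qed
  ultimately show ?thesis unfolding invertible_ideal_def using oneideal by blast
qed

lemma ssp_imp_strongly_isp:
  assumes "ssp_ring R" shows "strongly_isp_ring R"
  unfolding strongly_isp_ring_def
proof (intro allI impI)
  fix I assume I: "proper_ideal I R"
  then obtain Hs where Hs: "Hs \<noteq> []" "\<forall>H\<in>set Hs. radical_ideal H R" "I = ideal_prod_list R Hs"
    using assms by (auto simp: ssp_ring_def)
  have "I = carrier R \<cdot> I"
    using ideal_prod_one ideal_prod_commute oneideal proper_idealD(1)[OF I] by simp
  then show "\<exists>J Hs. invertible_ideal J R \<and> Hs \<noteq> [] \<and> (\<forall>H\<in>set Hs. radical_ideal H R) \<and>
      I = J \<cdot> ideal_prod_list R Hs"
    using carrier_invertible Hs by auto
qed

end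

theorem corollary4p8:
  fixes A :: "('a, 'b) ring_scheme" (structure)
  assumes "cring A" and "\<one> \<noteq> \<zero>"
  shows "(zpi_ring A \<longleftrightarrow> noetherian_ring A \<and> ssp_ring A) \<and>
    (noetherian_ring A \<and> ssp_ring A \<longleftrightarrow> noetherian_ring A \<and> strongly_isp_ring A)"
proof -
  interpret cring A by fact
  \<comment> \<open>The implications form a cycle: ZPI gives Noetherian and SSP, SSP gives strongly
    ISP, and a Noetherian strongly ISP-ring is ZPI through
    \<open>radical_divisor_ring\<close>.\<close>
  show ?thesis
    using zpi_imp_noetherian zpi_imp_ssp ssp_imp_strongly_isp
      noetherian_imp_zpi strongly_isp_imp_radical_divisor assms(2) by metis
qed

end
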